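(* Let $(A,\varrho_A,[\cdot,\cdot])$ be a skew-symmetric algebroid over a manifold $M$ equipped with a pseudo-Riemannian metric $g\in\Gamma(\mathsf{S}^2A^* )$ in $A$. Define $\langle\cdot:\cdot\rangle^s:\Gamma(A)\times\Gamma(A)\to\Gamma(A)$ by $$\langle X:Y\rangle^s=\sharp\big(\mathcal{L}^a_XY^\flat+\mathcal{L}^a_YX^\flat-d^a(g(X,Y))\big)$$ for $X,Y\in\Gamma(A)$. Then $\langle\cdot:\cdot\rangle^s$ is a symmetric bracket, and the symmetric Lie derivative $\mathcal{L}^s$ defined by it satisfies $\mathcal{L}^s_Xg=-\mathcal{L}^a_Xg$ for every $X\in\Gamma(A)$.
   Context: A skew-symmetric algebroid $(A,\varrho_A,[\cdot,\cdot])$ over $M$ is a vector bundle $A\to M$ with a vector bundle homomorphism $\varrho_A:A\to TM$ over the identity (anchor) and an $\mathbb{R}$-bilinear skew-symmetric map $[\cdot,\cdot]:\Gamma(A)\times\Gamma(A)\to\Gamma(A)$ with $[X,fY]=f[X,Y]+(\varrho_A\circ X)(f)\,Y$ for $X,Y\in\Gamma(A)$, $f\in C^\infty(M)$ (no Jacobi identity is assumed, and the anchor need not preserve brackets). A symmetric bracket is an $\mathbb{R}$-bilinear symmetric map $\langle\cdot:\cdot\rangle:\Gamma(A)\times\Gamma(A)\to\Gamma(A)$ with $\langle X:fY\rangle=f\langle X:Y\rangle+(\varrho_A\circ X)(f)Y$. A pseudo-Riemannian metric $g$ in $A$ is a nondegenerate section of $\mathsf{S}^2A^*$; $X^\flat=g(X,\cdot)$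 and $\sharp:A^*\to A$ is given by $g(\sharp(\omega),X)=\omega(X)$. For $f\in C^\infty(M)$, $(d^af)(X)=(\varrho_A\circ X)(f)$. The (alternating) Lie derivative is given on $\omega\in\Gamma(A^* )$ by $(\mathcal{L}^a_X\omega)(Y)=(\varrho_A\circ X)(\omega(Y))-\omega([X,Y])$ and on $g$ by $(\mathcal{L}^a_Xg)(Y,Z)=(\varrho_A\circ X)(g(Y,Z))-g([X,Y],Z)-g(Y,[X,Z])$. The symmetric Lie derivative of $g$ defined by a symmetric bracket $\langle\cdot:\cdot\rangle$ is $(\mathcal{L}^s_Xg)(Y,Z)=(\varrho_A\circ X)(g(Y,Z))-g(\langle X:Y\rangle,Z)-g(Y,\langle X:Z\rangle)$. *)

theory Defs
  imports "HOL-Analysis.Analysis" "HOL-Library.Function_Algebras"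
begin

section \<open>Linear algebra\<close>

instantiation "fun" :: (type, real_vector) real_vector
begin

definition "r *\<^sub>R f = (\<lambda>x. r *\<^sub>R f x)"

instance
  by standard (simp_all add: scaleR_fun_def fun_eq_iff scaleR_add_right scaleR_add_left)

end

definition linear_on :: "'v::real_vector set \<Rightarrow> ('v \<Rightarrow> 'w::real_vector) \<Rightarrow> bool" where
  "linear_on V f \<longleftrightarrow>
     (\<forall>u\<in>V. \<forall>v\<in>V. f (u + v) = f u + f v) \<and> (\<forall>c. \<forall>v\<in>V. f (c *\<^sub>R v) = c *\<^sub>R f v)"

text \<open>The model spaces \<open>\<real>\<^sup>n\<close> below are finite-dimensional spaces of class \<^class>\<open>real_inner\<close>. Unlike
  \<^class>\<open>euclidean_space\<close> this includes dimension 0, hence zero-dimensional manifolds (e.g. a point)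
  and bundles of rank 0.\<close>

definition finite_dim :: "'e::real_vector itself \<Rightarrow> bool" where
  "finite_dim _ \<longleftrightarrow> (\<exists>B. finite B \<and> span B = (UNIV :: 'e set))"

section \<open>Smooth maps between open subsets of vector spaces\<close>

text \<open>On an open set \<open>S\<close> of a finite-dimensional space, \<open>C_differentiable_on n S f\<close> says that \<open>f\<close> is of
  class \<open>C\<^sup>n\<close>: all directional derivatives of the differentiable map \<open>f\<close> are of class \<open>C\<^sup>n\<^sup>-\<^sup>1\<close>.\<close>

primrec C_differentiable_on ::
  "nat \<Rightarrow> 'a::real_normed_vector set \<Rightarrow> ('a \<Rightarrow> 'b::real_normed_vector) \<Rightarrow> bool" where
  "C_differentiable_on 0 S f \<longleftrightarrow> continuous_on S f"
| "C_differentiable_on (Suc n) S f \<longleftrightarrow> (\<forall>x\<in>S. f differentiable (at x)) \<and>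
     (\<forall>v. C_differentiable_on n S (\<lambda>x. frechet_derivative f (at x) v))"

definition smooth_on :: "'a::real_normed_vector set \<Rightarrow> ('a \<Rightarrow> 'b::real_normed_vector) \<Rightarrow> bool" where
  "smooth_on S f \<longleftrightarrow> (\<forall>n. C_differentiable_on n S f)"

section \<open>Manifolds\<close>

text \<open>The manifold is the whole type \<open>'m\<close>; the smooth structure is given by a (not necessarily
  maximal) atlas of charts \<open>x : U \<rightarrow> \<real>\<^sup>n\<close>, written as pairs \<open>(U, x)\<close>; the values of \<open>x\<close> off \<open>U\<close> are
  irrelevant.\<close>

type_synonym ('m, 'e) atlas = "('m set \<times> ('m \<Rightarrow> 'e)) set"

locale smooth_manifold =
  fixes atlas :: "('m::{t2_space, second_countable_topology}, 'e::real_inner) atlas"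
  assumes model_finite_dim: "finite_dim TYPE('e)"
    and charts_cover: "(\<Union>(U, x)\<in>atlas. U) = UNIV"
    and chart_open: "(U, x) \<in> atlas \<Longrightarrow> open U \<and> open (x ` U)"
    and chart_homeomorphism: "(U, x) \<in> atlas \<Longrightarrow> homeomorphism U (x ` U) x (inv_into U x)"
    and chart_transition:
      "(U, x) \<in> atlas \<Longrightarrow> (V, y) \<in> atlas \<Longrightarrow> smooth_on (x ` (U \<inter> V)) (y \<circ> inv_into U x)"

definition smooth_map_on ::
  "('m, 'e::real_inner) atlas \<Rightarrow> 'm set \<Rightarrow> ('m \<Rightarrow> 'b::real_normed_vector) \<Rightarrow> bool" where
  "smooth_map_on atlas W f \<longleftrightarrow> (\<forall>(U, x)\<in>atlas. smooth_on (x ` (U \<inter> W)) (f \<circ> inv_into U x))"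

definition smooth_functions :: "('m, 'e::real_inner) atlas \<Rightarrow> ('m \<Rightarrow> real) set" where
  "smooth_functions atlas = {f. smooth_map_on atlas UNIV f}"

section \<open>Vector bundles\<close>

text \<open>A bundle over \<open>'m\<close> is a family of fibres, which are linear subspaces of one vector space \<open>'v\<close>
  (the total space is \<open>{(p, v). v \<in> fibre E p}\<close>; any family of vector spaces embeds in this way, e.g.
  in its direct sum), together with local trivialisations \<open>(U, \<phi>)\<close>, where
  \<open>\<phi> p : fibre E p \<rightarrow> \<real>\<^sup>k\<close> for \<open>p \<in> U\<close>.\<close>

record ('m, 'v, 'k) vbundle =
  fibre :: "'m \<Rightarrow> 'v set"
  trivs :: "('m set \<times> ('m \<Rightarrow> 'v \<Rightarrow> 'k)) set"

text \<open>The inverse of a trivialisation, \<open>\<real>\<^sup>k \<rightarrow> fibre E p\<close>.\<close>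

definition triv_inv :: "('m, 'v, 'k) vbundle \<Rightarrow> ('m \<Rightarrow> 'v \<Rightarrow> 'k) \<Rightarrow> 'm \<Rightarrow> 'k \<Rightarrow> 'v" where
  "triv_inv E \<phi> p = inv_into (fibre E p) (\<phi> p)"

locale vector_bundle = smooth_manifold atlas
  for atlas :: "('m::{t2_space, second_countable_topology}, 'e::real_inner) atlas" +
  fixes E :: "('m, 'v::real_vector, 'k::real_inner) vbundle"
  assumes fibre_model_finite_dim: "finite_dim TYPE('k)"
    and fibre_subspace: "subspace (fibre E p)"
    and trivs_cover: "(\<Union>(U, \<phi>)\<in>trivs E. U) = UNIV"
    and triv_open: "(U, \<phi>) \<in> trivs E \<Longrightarrow> open U"
    and triv_iso: "(U, \<phi>) \<in> trivs E \<Longrightarrow> p \<in> U \<Longrightarrow>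
      linear_on (fibre E p) (\<phi> p) \<and> bij_betw (\<phi> p) (fibre E p) UNIV"
    and triv_transition: "(U, \<phi>) \<in> trivs E \<Longrightarrow> (V, \<psi>) \<in> trivs E \<Longrightarrow>
      smooth_map_on atlas (U \<inter> V) (\<lambda>p. \<psi> p (triv_inv E \<phi> p c))"

definition sections ::
  "('m, 'e::real_inner) atlas \<Rightarrow> ('m, 'v, 'k::real_inner) vbundle \<Rightarrow> ('m \<Rightarrow> 'v) set" where
  "sections atlas E = {X. (\<forall>p. X p \<in> fibre E p) \<and>
     (\<forall>(U, \<phi>)\<in>trivs E. smooth_map_on atlas U (\<lambda>p. \<phi> p (X p)))}"

text \<open>Vector bundle homomorphisms over the identity: fibrewise linear, with smooth local
  representatives.\<close>

definition bundle_hom ::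
  "('m, 'e::real_inner) atlas \<Rightarrow> ('m, 'v::real_vector, 'k) vbundle \<Rightarrow>
   ('m, 'w::real_vector, 'l::real_inner) vbundle \<Rightarrow> ('m \<Rightarrow> 'v \<Rightarrow> 'w) \<Rightarrow> bool" where
  "bundle_hom atlas E F h \<longleftrightarrow>
     (\<forall>p. linear_on (fibre E p) (h p) \<and> h p ` fibre E p \<subseteq> fibre F p) \<and>
     (\<forall>(U, \<phi>)\<in>trivs E. \<forall>(V, \<psi>)\<in>trivs F. \<forall>c.
        smooth_map_on atlas (U \<inter> V) (\<lambda>p. \<psi> p (h p (triv_inv E \<phi> p c))))"

section \<open>The tangent bundle\<close>

text \<open>A tangent vector at \<open>p\<close> is identified with its action on \<open>C\<^sup>\<infinity>(M)\<close>. The vector with components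
  \<open>w\<close> in the chart \<open>(U, x)\<close> is \<open>f \<mapsto> D(f \<circ> x\<^sup>-\<^sup>1)(x(p)) w\<close>, set to 0 off \<open>C\<^sup>\<infinity>(M)\<close> so that equality
  only depends on the action on smooth functions.\<close>

definition chart_tangent ::
  "('m, 'e::real_inner) atlas \<Rightarrow> 'm set \<Rightarrow> ('m \<Rightarrow> 'e) \<Rightarrow> 'm \<Rightarrow> 'e \<Rightarrow> ('m \<Rightarrow> real) \<Rightarrow> real" where
  "chart_tangent atlas U x p w = (\<lambda>f.
     if f \<in> smooth_functions atlas then frechet_derivative (f \<circ> inv_into U x) (at (x p)) w else 0)"

definition tangent_bundle ::
  "('m, 'e::real_inner) atlas \<Rightarrow> ('m, ('m \<Rightarrow> real) \<Rightarrow> real, 'e) vbundle" where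
  "tangent_bundle atlas =
     \<lparr>fibre = (\<lambda>p. {chart_tangent atlas U x p w | U x w. (U, x) \<in> atlas \<and> p \<in> U}),
      trivs = {(U, \<lambda>p. inv (chart_tangent atlas U x p)) | U x. (U, x) \<in> atlas}\<rparr>"

section \<open>Skew-symmetric algebroids and symmetric brackets\<close>

text \<open>The function \<open>(\<rho> \<circ> X)(f)\<close>.\<close>

definition anchor_deriv ::
  "('m \<Rightarrow> 'v \<Rightarrow> ('m \<Rightarrow> real) \<Rightarrow> real) \<Rightarrow> ('m \<Rightarrow> 'v) \<Rightarrow> ('m \<Rightarrow> real) \<Rightarrow> 'm \<Rightarrow> real" where
  "anchor_deriv \<rho> X f = (\<lambda>p. \<rho> p (X p) f)"

text \<open>The \<open>\<real>\<close>-bilinear operations \<open>\<Gamma>(A) \<times> \<Gamma>(A) \<rightarrow> \<Gamma>(A)\<close> with the Leibniz rule in the second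
  argument, common to skew-symmetric and symmetric brackets.\<close>

definition leibniz_bracket ::
  "('m, 'e::real_inner) atlas \<Rightarrow> ('m, 'v::real_vector, 'k::real_inner) vbundle \<Rightarrow>
   ('m \<Rightarrow> 'v \<Rightarrow> ('m \<Rightarrow> real) \<Rightarrow> real) \<Rightarrow> (('m \<Rightarrow> 'v) \<Rightarrow> ('m \<Rightarrow> 'v) \<Rightarrow> ('m \<Rightarrow> 'v)) \<Rightarrow> bool" where
  "leibniz_bracket atlas A \<rho> b \<longleftrightarrow>
     (\<forall>X\<in>sections atlas A. \<forall>Y\<in>sections atlas A. b X Y \<in> sections atlas A) \<and>
     (\<forall>X\<in>sections atlas A. linear_on (sections atlas A) (\<lambda>Y. b X Y)) \<and>
     (\<forall>Y\<in>sections atlas A. linear_on (sections atlas A) (\<lambda>X. b X Y)) \<and>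
     (\<forall>X\<in>sections atlas A. \<forall>Y\<in>sections atlas A. \<forall>f\<in>smooth_functions atlas.
        b X (\<lambda>p. f p *\<^sub>R Y p) = (\<lambda>p. f p *\<^sub>R b X Y p + anchor_deriv \<rho> X f p *\<^sub>R Y p))"

locale skew_symmetric_algebroid = vector_bundle atlas A
  for atlas :: "('m::{t2_space, second_countable_topology}, 'e::real_inner) atlas"
    and A :: "('m, 'v::real_vector, 'k::real_inner) vbundle" +
  fixes \<rho> :: "'m \<Rightarrow> 'v \<Rightarrow> ('m \<Rightarrow> real) \<Rightarrow> real"
    and br :: "('m \<Rightarrow> 'v) \<Rightarrow> ('m \<Rightarrow> 'v) \<Rightarrow> ('m \<Rightarrow> 'v)"
  assumes anchor_hom: "bundle_hom atlas A (tangent_bundle atlas) \<rho>"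
    and bracket_leibniz: "leibniz_bracket atlas A \<rho> br"
    and bracket_skew: "X \<in> sections atlas A \<Longrightarrow> Y \<in> sections atlas A \<Longrightarrow> br X Y = - br Y X"

definition symmetric_bracket ::
  "('m, 'e::real_inner) atlas \<Rightarrow> ('m, 'v::real_vector, 'k::real_inner) vbundle \<Rightarrow>
   ('m \<Rightarrow> 'v \<Rightarrow> ('m \<Rightarrow> real) \<Rightarrow> real) \<Rightarrow> (('m \<Rightarrow> 'v) \<Rightarrow> ('m \<Rightarrow> 'v) \<Rightarrow> ('m \<Rightarrow> 'v)) \<Rightarrow> bool" where
  "symmetric_bracket atlas A \<rho> b \<longleftrightarrow> leibniz_bracket atlas A \<rho> b \<and>
     (\<forall>X\<in>sections atlas A. \<forall>Y\<in>sections atlas A. b X Y = b Y X)"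

section \<open>Covector fields and metrics\<close>

text \<open>\<open>\<Gamma>(A\<^sup>*)\<close>; elements of the dual of a fibre are linear forms, set to 0 off the fibre.\<close>

definition covector_fields ::
  "('m, 'e::real_inner) atlas \<Rightarrow> ('m, 'v::real_vector, 'k::real_inner) vbundle \<Rightarrow>
   ('m \<Rightarrow> 'v \<Rightarrow> real) set" where
  "covector_fields atlas A = {\<omega>.
     (\<forall>p. linear_on (fibre A p) (\<omega> p) \<and> (\<forall>v. v \<notin> fibre A p \<longrightarrow> \<omega> p v = 0)) \<and>
     (\<forall>(U, \<phi>)\<in>trivs A. \<forall>c. smooth_map_on atlas U (\<lambda>p. \<omega> p (triv_inv A \<phi> p c)))}"

text \<open>The smooth function \<open>\<omega>(Y)\<close>.\<close>

definition pairing :: "('m \<Rightarrow> 'v \<Rightarrow> real) \<Rightarrow> ('m \<Rightarrow> 'v) \<Rightarrow> 'm \<Rightarrow> real" where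
  "pairing \<omega> Y = (\<lambda>p. \<omega> p (Y p))"

definition pseudo_riemannian_metric ::
  "('m, 'e::real_inner) atlas \<Rightarrow> ('m, 'v::real_vector, 'k::real_inner) vbundle \<Rightarrow>
   ('m \<Rightarrow> 'v \<Rightarrow> 'v \<Rightarrow> real) \<Rightarrow> bool" where
  "pseudo_riemannian_metric atlas A g \<longleftrightarrow>
     (\<forall>p. \<forall>v\<in>fibre A p. linear_on (fibre A p) (g p v)) \<and>
     (\<forall>p. \<forall>v\<in>fibre A p. \<forall>w\<in>fibre A p. g p v w = g p w v) \<and>
     (\<forall>(U, \<phi>)\<in>trivs A. \<forall>c d.
        smooth_map_on atlas U (\<lambda>p. g p (triv_inv A \<phi> p c) (triv_inv A \<phi> p d))) \<and>
     (\<forall>p. \<forall>v\<in>fibre A p. (\<forall>w\<in>fibre A p. g p v w = 0) \<longrightarrow> v = 0)"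

text \<open>The smooth function \<open>g(Y, Z)\<close>.\<close>

definition metric_eval ::
  "('m \<Rightarrow> 'v \<Rightarrow> 'v \<Rightarrow> real) \<Rightarrow> ('m \<Rightarrow> 'v) \<Rightarrow> ('m \<Rightarrow> 'v) \<Rightarrow> 'm \<Rightarrow> real" where
  "metric_eval g Y Z = (\<lambda>p. g p (Y p) (Z p))"

definition flat ::
  "('m, 'v, 'k) vbundle \<Rightarrow> ('m \<Rightarrow> 'v \<Rightarrow> 'v \<Rightarrow> real) \<Rightarrow> ('m \<Rightarrow> 'v) \<Rightarrow> 'm \<Rightarrow> 'v \<Rightarrow> real" where
  "flat A g X = (\<lambda>p v. if v \<in> fibre A p then g p (X p) v else 0)"

definition sharp ::
  "('m, 'v, 'k) vbundle \<Rightarrow> ('m \<Rightarrow> 'v \<Rightarrow> 'v \<Rightarrow> real) \<Rightarrow> ('m \<Rightarrow> 'v \<Rightarrow> real) \<Rightarrow> 'm \<Rightarrow> 'v" where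
  "sharp A g \<omega> = (\<lambda>p. THE v. v \<in> fibre A p \<and> (\<forall>w\<in>fibre A p. g p v w = \<omega> p w))"

section \<open>Differential and Lie derivatives\<close>

definition differential ::
  "('m, 'v, 'k) vbundle \<Rightarrow> ('m \<Rightarrow> 'v \<Rightarrow> ('m \<Rightarrow> real) \<Rightarrow> real) \<Rightarrow> ('m \<Rightarrow> real) \<Rightarrow> 'm \<Rightarrow> 'v \<Rightarrow> real" where
  "differential A \<rho> f = (\<lambda>p v. if v \<in> fibre A p then \<rho> p v f else 0)"

text \<open>\<open>\<L>\<^sup>a\<^sub>X \<omega>\<close> is the covector field determined by its values on sections.\<close>

definition lie_covector ::
  "('m, 'e::real_inner) atlas \<Rightarrow> ('m, 'v::real_vector, 'k::real_inner) vbundle \<Rightarrow>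
   ('m \<Rightarrow> 'v \<Rightarrow> ('m \<Rightarrow> real) \<Rightarrow> real) \<Rightarrow> (('m \<Rightarrow> 'v) \<Rightarrow> ('m \<Rightarrow> 'v) \<Rightarrow> ('m \<Rightarrow> 'v)) \<Rightarrow>
   ('m \<Rightarrow> 'v) \<Rightarrow> ('m \<Rightarrow> 'v \<Rightarrow> real) \<Rightarrow> 'm \<Rightarrow> 'v \<Rightarrow> real" where
  "lie_covector atlas A \<rho> br X \<omega> = (THE \<eta>. \<eta> \<in> covector_fields atlas A \<and>
     (\<forall>Y\<in>sections atlas A. pairing \<eta> Y = anchor_deriv \<rho> X (pairing \<omega> Y) - pairing \<omega> (br X Y)))"

text \<open>\<open>(\<L>\<^sub>X g)(Y, Z)\<close> for an arbitrary bracket \<open>b\<close>: this is \<open>\<L>\<^sup>a\<close> if \<open>b\<close> is the skew-symmetric bracket of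
  the algebroid and \<open>\<L>\<^sup>s\<close> if \<open>b\<close> is a symmetric bracket.\<close>

definition lie_metric ::
  "('m \<Rightarrow> 'v \<Rightarrow> ('m \<Rightarrow> real) \<Rightarrow> real) \<Rightarrow> (('m \<Rightarrow> 'v) \<Rightarrow> ('m \<Rightarrow> 'v) \<Rightarrow> ('m \<Rightarrow> 'v)) \<Rightarrow>
   ('m \<Rightarrow> 'v) \<Rightarrow> ('m \<Rightarrow> 'v \<Rightarrow> 'v \<Rightarrow> real) \<Rightarrow> ('m \<Rightarrow> 'v) \<Rightarrow> ('m \<Rightarrow> 'v) \<Rightarrow> 'm \<Rightarrow> real" where
  "lie_metric \<rho> b X g Y Z =
     anchor_deriv \<rho> X (metric_eval g Y Z) - metric_eval g (b X Y) Z - metric_eval g Y (b X Z)"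

definition metric_bracket ::
  "('m, 'e::real_inner) atlas \<Rightarrow> ('m, 'v::real_vector, 'k::real_inner) vbundle \<Rightarrow>
   ('m \<Rightarrow> 'v \<Rightarrow> ('m \<Rightarrow> real) \<Rightarrow> real) \<Rightarrow> (('m \<Rightarrow> 'v) \<Rightarrow> ('m \<Rightarrow> 'v) \<Rightarrow> ('m \<Rightarrow> 'v)) \<Rightarrow>
   ('m \<Rightarrow> 'v \<Rightarrow> 'v \<Rightarrow> real) \<Rightarrow> ('m \<Rightarrow> 'v) \<Rightarrow> ('m \<Rightarrow> 'v) \<Rightarrow> 'm \<Rightarrow> 'v" where
  "metric_bracket atlas A \<rho> br g X Y = sharp A g
     (lie_covector atlas A \<rho> br X (flat A g Y) + lie_covector atlas A \<rho> br Y (flat A g X)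
      - differential A \<rho> (metric_eval g X Y))"

end

theory Submission
  imports Defs
begin

text \<open>Write \<open>X(f)\<close> for \<open>(\<rho> \<circ> X)(f)\<close>. Pairing the definition of the bracket with a section \<open>Z\<close> gives the
  Koszul-type formula
  \<open>g(\<langle>X:Y\<rangle>, Z) = X(g(Y,Z)) - g(Y,[X,Z]) + Y(g(X,Z)) - g(X,[Y,Z]) - Z(g(X,Y))\<close>
  (\<open>metric_bracket_koszul\<close>), and \<open>\<langle>X:Y\<rangle>\<close> is determined by these values because \<open>g\<close> is nondegenerate
  (\<open>section_eqI\<close>). The right-hand side is symmetric in \<open>X\<close> and \<open>Y\<close>. Under \<open>Y \<mapsto> f Y\<close> the terms
  \<open>Z(f) g(X,Y)\<close> from \<open>[f Y, Z]\<close> and from \<open>Z(g(X, f Y))\<close> cancel, so that only the Leibniz term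
  \<open>X(f) g(Y,Z)\<close> is left (\<open>metric_bracket_leibniz\<close>). Adding the formula to itself with \<open>Y\<close> and \<open>Z\<close>
  exchanged gives \<open>2 X(g(Y,Z)) - g([X,Y],Z) - g(Y,[X,Z])\<close>. Subtracted from \<open>X(g(Y,Z))\<close> this is the
  claim about the Lie derivatives (\<open>lie_metric_metric_bracket\<close>).

  The bulk of the work is to see that the objects in the formula exist and are smooth.

  The Lie derivative \<open>\<L>\<^sup>a\<^sub>X \<omega>\<close> is specified by its values on global sections, so a
  \<open>C\<^sup>\<infinity>(M)\<close>-linear map from sections to functions has to come from a unique covector field
  (\<open>covector_field_of_tensorial\<close>). This requires global sections with prescribed values, obtained by
  cutting off local frames with smooth bump functions (\<open>bump_function\<close>), which in turn rest on the
  smoothness of \<open>exp (-1/t)\<close> at 0.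

  The section \<open>\<sharp> \<omega>\<close> exists because \<open>\<flat>\<close> is onto on each fibre (\<open>metric_represents\<close>). Its coefficients
  in a local frame solve a linear system with the Gram matrix of \<open>g\<close>, and they are smooth since
  Gaussian elimination can be carried out with smooth functions near each point
  (\<open>linear_system_solution_smooth\<close>).

  Finally \<open>X(f)\<close> is smooth because the anchor of a section has smooth components in each chart
  (\<open>anchor_frame_smooth\<close>), and \<open>X\<close> acts as a derivation because tangent vectors do.\<close>

section \<open>Finite-dimensional inner product spaces\<close>

text \<open>One basis is fixed for each model space, so that the local frames of all trivialisations of a
  bundle have the same index set.\<close>

definition onb :: "'a::real_inner set" where
  "onb = (SOME B. finite B \<and> (\<forall>b\<in>B. \<forall>c\<in>B. b \<bullet> c = (if b = c then 1 else 0)) \<and>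
            (\<forall>x. x = (\<Sum>b\<in>B. (x \<bullet> b) *\<^sub>R b)))"

lemma orthonormal_basis_exists:
  assumes "finite_dim TYPE('a::real_inner)"
  shows "\<exists>B::'a set. finite B \<and> (\<forall>b\<in>B. \<forall>c\<in>B. b \<bullet> c = (if b = c then 1 else 0)) \<and>
            (\<forall>x. x = (\<Sum>b\<in>B. (x \<bullet> b) *\<^sub>R b))"
proof -
  obtain B0 :: "'a set" where B0: "finite B0" "span B0 = UNIV"
    using assms unfolding finite_dim_def by blast
  obtain C :: "'a set" where C: "finite C" "span C = UNIV" "pairwise orthogonal C"
    using basis_orthogonal[OF B0(1)] B0(2) by metis
  define D where "D = (\<lambda>c. c /\<^sub>R norm c) ` (C - {0})"
  have fin: "finite D" using C(1) by (simp add: D_def)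
  have on: "b \<bullet> c = (if b = c then 1 else 0)" if bc: "b \<in> D" "c \<in> D" for b c
  proof -
    obtain b' c' where b': "b' \<in> C" "b' \<noteq> 0" "b = b' /\<^sub>R norm b'"
      and c': "c' \<in> C" "c' \<noteq> 0" "c = c' /\<^sub>R norm c'"
      using bc by (auto simp: D_def)
    show ?thesis
    proof (cases "b' = c'")
      case True
      then show ?thesis using b' c' by (simp add: dot_square_norm power2_eq_square)
    next
      case False
      then have 0: "b' \<bullet> c' = 0"
        using C(3) b'(1) c'(1) by (auto simp: pairwise_def orthogonal_def)
      then have "b \<bullet> c = 0" using b' c' by simp
      moreover have "b \<bullet> b = 1" using b' by (simp add: dot_square_norm power2_eq_square)
      ultimately show ?thesis by auto
    qed
  qed
  have "C \<subseteq> span D"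
  proof
    fix c assume c: "c \<in> C"
    show "c \<in> span D"
    proof (cases "c = 0")
      case False
      then have "c /\<^sub>R norm c \<in> span D" using c by (auto simp: D_def intro: span_base)
      then have "norm c *\<^sub>R (c /\<^sub>R norm c) \<in> span D" by (rule span_scale)
      then show ?thesis using False by simp
    qed (simp add: span_zero)
  qed
  then have spanD: "span D = UNIV"
    using C(2) span_minimal[of C "span D"] by auto
  have ex: "x = (\<Sum>b\<in>D. (x \<bullet> b) *\<^sub>R b)" for x
  proof -
    let ?z = "x - (\<Sum>b\<in>D. (x \<bullet> b) *\<^sub>R b)"
    have "?z \<bullet> c = 0" if c: "c \<in> D" for c
    proof -
      have "(\<Sum>b\<in>D. (x \<bullet> b) *\<^sub>R b) \<bullet> c = (\<Sum>b\<in>D. if b = c then x \<bullet> b else 0)"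
        unfolding inner_sum_left by (intro sum.cong) (auto simp: on c)
      then show ?thesis using fin c by (simp add: inner_diff_left)
    qed
    then have "span D \<subseteq> {y. ?z \<bullet> y = 0}"
      by (intro span_minimal) (auto simp: subspace_hyperplane)
    then have "?z \<bullet> ?z = 0" unfolding spanD by blast
    then have "?z = 0" by simp
    then show ?thesis by simp
  qed
  show ?thesis using fin on ex by blast
qed

lemma
  assumes "finite_dim TYPE('a::real_inner)"
  shows finite_onb: "finite (onb :: 'a set)"
    and inner_onb: "\<And>b c :: 'a. b \<in> onb \<Longrightarrow> c \<in> onb \<Longrightarrow> b \<bullet> c = (if b = c then 1 else 0)"
    and onb_expansion: "\<And>x :: 'a. (\<Sum>b\<in>onb. (x \<bullet> b) *\<^sub>R b) = x"
  using someI_ex[OF orthonormal_basis_exists[OF assms]] unfolding onb_def[symmetric] by auto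

lemma inner_onb_sum:
  assumes "finite_dim TYPE('a::real_inner)" "c \<in> (onb :: 'a set)"
  shows "(\<Sum>b\<in>onb. y b *\<^sub>R b) \<bullet> c = y c"
proof -
  have "(\<Sum>b\<in>onb. y b *\<^sub>R b) \<bullet> c = (\<Sum>b\<in>onb. if b = c then y b else 0)"
    unfolding inner_sum_left by (intro sum.cong) (auto simp: inner_onb[OF assms(1)] assms(2))
  then show ?thesis using assms by (simp add: finite_onb)
qed

text \<open>A box spanned by \<open>insert a B\<close> is the continuous image of the product of an interval and a box
  spanned by \<open>B\<close>. Closed balls are compact as closed subsets of such boxes.\<close>

lemma compact_coordinate_box:
  fixes B :: "'a::real_normed_vector set"
  assumes "finite B"
  shows "compact {\<Sum>b\<in>B. t b *\<^sub>R b | t. \<forall>b\<in>B. \<bar>t b\<bar> \<le> (R::real)}" (is "compact (?K B)")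
  using assms
proof (induction B)
  case (insert a B)
  have "?K (insert a B) = (\<lambda>(s, y). s *\<^sub>R a + y) ` ({-R..R} \<times> ?K B)" (is "?L = ?Q")
  proof
    show "?L \<subseteq> ?Q"
    proof
      fix z assume "z \<in> ?L"
      then obtain t where t: "z = (\<Sum>b\<in>insert a B. t b *\<^sub>R b)" "\<forall>b\<in>insert a B. \<bar>t b\<bar> \<le> R" by blast
      then have "z = t a *\<^sub>R a + (\<Sum>b\<in>B. t b *\<^sub>R b)" using insert by simp
      moreover have "(\<Sum>b\<in>B. t b *\<^sub>R b) \<in> ?K B" using t by blast
      moreover have "t a \<in> {-R..R}" using t by auto
      ultimately show "z \<in> ?Q" by (intro image_eqI[of _ _ "(t a, \<Sum>b\<in>B. t b *\<^sub>R b)"]) auto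
    qed
    show "?Q \<subseteq> ?L"
    proof clarify
      fix s t assume s: "s \<in> {-R..R}" and t: "\<forall>b\<in>B. \<bar>t b\<bar> \<le> R"
      have "(\<Sum>b\<in>B. (if b = a then s else t b) *\<^sub>R b) = (\<Sum>b\<in>B. t b *\<^sub>R b)"
        using insert by (intro sum.cong) auto
      then show "\<exists>u. s *\<^sub>R a + (\<Sum>b\<in>B. t b *\<^sub>R b) = (\<Sum>b\<in>insert a B. u b *\<^sub>R b) \<and>
                 (\<forall>b\<in>insert a B. \<bar>u b\<bar> \<le> R)"
        using insert s t by (intro exI[of _ "\<lambda>b. if b = a then s else t b"]) auto
    qed
  qed
  moreover have "compact ?Q"
    unfolding case_prod_unfold
    by (intro compact_continuous_image compact_Times insert.IH compact_Icc continuous_on_add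
        continuous_on_scaleR continuous_on_fst continuous_on_snd continuous_on_id
        continuous_on_const)
  ultimately show ?case by simp
qed simp

lemma compact_cball_finite_dim:
  assumes "finite_dim TYPE('a::real_inner)"
  shows "compact (cball (a :: 'a) r)"
proof -
  let ?K = "{\<Sum>b\<in>onb. t b *\<^sub>R b | t. \<forall>b\<in>onb. \<bar>t b\<bar> \<le> r} :: 'a set"
  have "compact ?K" using compact_coordinate_box[OF finite_onb[OF assms]] .
  moreover have "cball 0 r \<subseteq> ?K"
  proof
    fix x :: 'a assume x: "x \<in> cball 0 r"
    have "\<bar>x \<bullet> b\<bar> \<le> r" if "b \<in> onb" for b
    proof -
      have "b \<bullet> b = 1" using inner_onb[OF assms that that] by simp
      then have "norm b = 1" by (simp add: norm_eq_1)
      then show ?thesis using Cauchy_Schwarz_ineq2[of x b] x by simp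
    qed
    then show "x \<in> ?K" using onb_expansion[OF assms, of x, symmetric] by blast
  qed
  ultimately have "compact (cball (0::'a) r)"
    using compact_Int_closed[OF _ closed_cball, of ?K 0 r] by (simp add: inf.absorb2)
  then have "compact ((\<lambda>x. a + x) ` cball 0 r)"
    by (intro compact_continuous_image continuous_intros)
  then show ?thesis by (simp add: cball_translation[symmetric])
qed

section \<open>Calculus of smooth maps\<close>

lemma C_differentiable_on_SucD:
  assumes "C_differentiable_on (Suc n) S f" "x \<in> S"
  shows "(f has_derivative frechet_derivative f (at x)) (at x)"
  using assms by (simp add: frechet_derivative_works)

lemma C_differentiable_on_cong:
  assumes "open S" "\<And>x. x \<in> S \<Longrightarrow> f x = g x" "C_differentiable_on n S f"
  shows "C_differentiable_on n S g"
  using assms(2,3)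
proof (induction n arbitrary: f g)
  case 0
  then show ?case using continuous_on_cong by fastforce
next
  case (Suc n)
  have g: "(g has_derivative frechet_derivative f (at x)) (at x)" if "x \<in> S" for x
    using has_derivative_transform_within_open[OF C_differentiable_on_SucD[OF Suc.prems(2) that]
        assms(1) that] Suc.prems(1) by simp
  then have "frechet_derivative f (at x) = frechet_derivative g (at x)" if "x \<in> S" for x
    using frechet_derivative_at that by blast
  then have "C_differentiable_on n S (\<lambda>x. frechet_derivative g (at x) v)" for v
    using Suc.IH[of "\<lambda>x. frechet_derivative f (at x) v"] Suc.prems(2) by simp
  then show ?case using g by (auto simp: differentiable_def)
qed

lemma C_differentiable_on_SucI:
  assumes "open S" "\<And>x. x \<in> S \<Longrightarrow> (f has_derivative f' x) (at x)"
    and "\<And>v. C_differentiable_on n S (\<lambda>x. f' x v)"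
  shows "C_differentiable_on (Suc n) S f"
proof -
  have "f' x = frechet_derivative f (at x)" if "x \<in> S" for x
    using frechet_derivative_at assms(2) that by blast
  then have "C_differentiable_on n S (\<lambda>x. frechet_derivative f (at x) v)" for v
    using C_differentiable_on_cong[OF assms(1) _ assms(3)] by simp
  then show ?thesis using assms(2) by (auto simp: differentiable_def)
qed

lemma C_differentiable_on_pred:
  "C_differentiable_on (Suc n) S f \<Longrightarrow> C_differentiable_on n S f"
proof (induction n arbitrary: f)
  case 0
  then show ?case
    by (simp add: continuous_at_imp_continuous_on differentiable_imp_continuous_within)
qed auto

lemma C_differentiable_on_subset:
  "C_differentiable_on n S f \<Longrightarrow> T \<subseteq> S \<Longrightarrow> C_differentiable_on n T f"
  by (induction n arbitrary: f) (auto intro: continuous_on_subset)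

lemma C_differentiable_on_local:
  assumes "\<And>x. x \<in> S \<Longrightarrow> \<exists>T. open T \<and> x \<in> T \<and> C_differentiable_on n T f"
  shows "C_differentiable_on n S f"
  using assms
proof (induction n arbitrary: f)
  case 0
  have "continuous (at x) f" if "x \<in> S" for x
    using 0[OF that] continuous_on_eq_continuous_at by fastforce
  then show ?case by (simp add: continuous_at_imp_continuous_on)
next
  case (Suc n)
  have "C_differentiable_on n S (\<lambda>x. frechet_derivative f (at x) v)" for v
  proof (rule Suc.IH)
    fix x assume "x \<in> S"
    then show "\<exists>T. open T \<and> x \<in> T \<and> C_differentiable_on n T (\<lambda>x. frechet_derivative f (at x) v)"
      using Suc.prems by fastforce
  qed
  moreover have "f differentiable (at x)" if "x \<in> S" for x
    using Suc.prems[OF that] by auto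
  ultimately show ?case by simp
qed

lemma C_differentiable_on_const: "C_differentiable_on n S (\<lambda>x. c)"
proof (induction n arbitrary: c)
  case (Suc n)
  have "frechet_derivative (\<lambda>x. c) (at x) v = 0" for x :: 'a and v
    by simp
  then show ?case using Suc.IH by simp
qed simp

lemma C_differentiable_on_add:
  assumes "open S" "C_differentiable_on n S f" "C_differentiable_on n S g"
  shows "C_differentiable_on n S (\<lambda>x. f x + g x)"
  using assms(2,3)
proof (induction n arbitrary: f g)
  case 0
  then show ?case by (simp add: continuous_on_add)
next
  case (Suc n)
  show ?case
  proof (rule C_differentiable_on_SucI[OF assms(1)])
    show "((\<lambda>x. f x + g x) has_derivative
      (\<lambda>v. frechet_derivative f (at x) v + frechet_derivative g (at x) v)) (at x)" if "x \<in> S" for x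
      using C_differentiable_on_SucD Suc.prems that by (blast intro: has_derivative_add)
    show "C_differentiable_on n S
       (\<lambda>x. frechet_derivative f (at x) v + frechet_derivative g (at x) v)" for v
      using Suc by simp
  qed
qed

lemma C_differentiable_on_sum:
  assumes "open S" "\<And>i. i \<in> I \<Longrightarrow> C_differentiable_on n S (f i)"
  shows "C_differentiable_on n S (\<lambda>x. \<Sum>i\<in>I. f i x)"
  using assms(2)
proof (induction I rule: infinite_finite_induct)
  case (insert i I)
  then show ?case
    using C_differentiable_on_add[OF assms(1), of n "f i" "\<lambda>x. \<Sum>i\<in>I. f i x"] by simp
qed (simp_all add: C_differentiable_on_const)

lemma C_differentiable_on_bilinear:
  assumes "open S" "bounded_bilinear B" "C_differentiable_on n S f" "C_differentiable_on n S g"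
  shows "C_differentiable_on n S (\<lambda>x. B (f x) (g x))"
  using assms(3,4)
proof (induction n arbitrary: f g)
  case 0
  then show ?case by (simp add: bounded_bilinear.continuous_on[OF assms(2)])
next
  case (Suc n)
  show ?case
  proof (rule C_differentiable_on_SucI[OF assms(1)])
    show "((\<lambda>x. B (f x) (g x)) has_derivative (\<lambda>v. B (f x) (frechet_derivative g (at x) v) +
            B (frechet_derivative f (at x) v) (g x))) (at x)" if "x \<in> S" for x
      using C_differentiable_on_SucD[OF Suc.prems(1) that] C_differentiable_on_SucD[OF Suc.prems(2) that]
      by (rule bounded_bilinear.FDERIV[OF assms(2)])
    show "C_differentiable_on n S (\<lambda>x. B (f x) (frechet_derivative g (at x) v) +
            B (frechet_derivative f (at x) v) (g x))" for v
      using Suc.prems C_differentiable_on_pred[OF Suc.prems(1)] C_differentiable_on_pred[OF Suc.prems(2)]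
      by (intro C_differentiable_on_add[OF assms(1)] Suc.IH) simp_all
  qed
qed

lemma C_differentiable_on_inverse:
  fixes f :: "'a::real_normed_vector \<Rightarrow> real"
  assumes "open S" "C_differentiable_on n S f" "\<And>x. x \<in> S \<Longrightarrow> f x \<noteq> 0"
  shows "C_differentiable_on n S (\<lambda>x. inverse (f x))"
  using assms(2)
proof (induction n)
  case 0
  then show ?case using assms(3) by (auto intro!: continuous_on_inverse)
next
  case (Suc n)
  note mult = C_differentiable_on_bilinear[OF assms(1) bounded_bilinear_mult]
  have inv: "C_differentiable_on n S (\<lambda>x. inverse (f x))"
    by (rule Suc.IH[OF C_differentiable_on_pred[OF Suc.prems]])
  have df: "C_differentiable_on n S (\<lambda>x. frechet_derivative f (at x) v)" for v
    using Suc.prems by simp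
  show ?case
  proof (rule C_differentiable_on_SucI[OF assms(1)])
    show "((\<lambda>x. inverse (f x)) has_derivative
        (\<lambda>v. (- 1) * (inverse (f x) * frechet_derivative f (at x) v * inverse (f x)))) (at x)"
      if "x \<in> S" for x
      using Deriv.has_derivative_inverse[OF assms(3)[OF that] C_differentiable_on_SucD[OF Suc.prems that]]
      by simp
    show "C_differentiable_on n S
        (\<lambda>x. (- 1) * (inverse (f x) * frechet_derivative f (at x) v * inverse (f x)))" for v
      by (rule mult[OF C_differentiable_on_const mult[OF mult[OF inv df] inv]])
  qed
qed

text \<open>The family \<open>exp (-1/t) / t\<^sup>k\<close>, extended by 0 to \<open>t \<le> 0\<close>, is closed under differentiation up to
  linear combinations. This gives the smoothness of \<open>exp (-1/t)\<close> at 0 (the case \<open>k = 0\<close>) by an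
  induction in which \<open>k\<close> varies.\<close>

definition flat_exp :: "nat \<Rightarrow> real \<Rightarrow> real" where
  "flat_exp k t = (if t > 0 then exp (- 1 / t) / t ^ k else 0)"

lemma flat_exp_tendsto_0: "(flat_exp k \<longlongrightarrow> 0) (at 0)"
proof (rule filterlim_split_at)
  have "\<forall>\<^sub>F t in at_left 0. flat_exp k t = 0"
    unfolding eventually_at_filter by (auto simp: flat_exp_def)
  then show "(flat_exp k \<longlongrightarrow> 0) (at_left 0)" by (rule tendsto_eventually)
  have "((\<lambda>t::real. inverse t ^ k / exp (inverse t)) \<longlongrightarrow> 0) (at_right 0)"
    by (rule filterlim_compose[OF tendsto_power_div_exp_0 filterlim_inverse_at_top_right])
  moreover have "\<forall>\<^sub>F t in at_right 0. inverse t ^ k / exp (inverse t) = flat_exp k t"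
    unfolding eventually_at_filter
    by (auto simp: flat_exp_def exp_minus field_simps power_inverse)
  ultimately show "(flat_exp k \<longlongrightarrow> 0) (at_right 0)"
    by (rule Lim_transform_eventually)
qed

lemma flat_exp_deriv:
  "(flat_exp k has_real_derivative flat_exp (k + 2) t - real k * flat_exp (k + 1) t) (at t)"
proof -
  consider "t > 0" | "t < 0" | "t = 0" by linarith
  then show ?thesis
  proof cases
    case 1
    have "((\<lambda>t. exp (- 1 / t) / t ^ k) has_real_derivative
      flat_exp (k + 2) t - real k * flat_exp (k + 1) t) (at t)"
    proof (cases k)
      case 0
      then show ?thesis
        using 1 by (auto intro!: derivative_eq_intros simp: flat_exp_def power2_eq_square)
    next
      case (Suc j)
      have "((\<lambda>t. exp (- 1 / t) / t ^ Suc j) has_real_derivative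
        (exp (- 1 / t) * (1 / t\<^sup>2) * t ^ Suc j - exp (- 1 / t) * (real (Suc j) * t ^ j)) /
          (t ^ Suc j * t ^ Suc j)) (at t)"
        using 1 by (auto intro!: derivative_eq_intros simp: power2_eq_square)
          (cases j; simp add: algebra_simps)
      moreover have "(exp (- 1 / t) * (1 / t\<^sup>2) * t ^ Suc j - exp (- 1 / t) * (real (Suc j) * t ^ j)) /
          (t ^ Suc j * t ^ Suc j) = flat_exp (k + 2) t - real k * flat_exp (k + 1) t"
        using 1 Suc by (simp add: flat_exp_def field_simps power2_eq_square)
      ultimately show ?thesis using Suc by simp
    qed
    then show ?thesis
      by (rule has_field_derivative_transform_within_open[of _ _ _ "{0<..}"])
         (use 1 in \<open>auto simp: flat_exp_def\<close>)
  next
    case 2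
    have "((\<lambda>t. 0) has_real_derivative flat_exp (k + 2) t - real k * flat_exp (k + 1) t) (at t)"
      using 2 by (simp add: flat_exp_def)
    then show ?thesis
      by (rule has_field_derivative_transform_within_open[of _ _ _ "{..<0}"])
         (use 2 in \<open>auto simp: flat_exp_def\<close>)
  next
    case 3
    have "(\<lambda>h. (flat_exp k (0 + h) - flat_exp k 0) / h) = flat_exp (Suc k)"
      by (auto simp: flat_exp_def fun_eq_iff)
    then have "(flat_exp k has_real_derivative 0) (at 0)"
      using flat_exp_tendsto_0[of "Suc k"] by (simp add: DERIV_def)
    then show ?thesis using 3 by (simp add: flat_exp_def)
  qed
qed

lemma C_differentiable_on_flat_exp:
  assumes "open S" "C_differentiable_on n S f"
  shows "C_differentiable_on n S (\<lambda>x. flat_exp k (f x))"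
  using assms(2)
proof (induction n arbitrary: k)
  case 0
  have "continuous_on UNIV (flat_exp k)"
    using DERIV_isCont[OF flat_exp_deriv] by (simp add: continuous_at_imp_continuous_on)
  then show ?case
    using 0 continuous_on_compose2[of UNIV "flat_exp k" S f] by auto
next
  case (Suc n)
  note mult = C_differentiable_on_bilinear[OF assms(1) bounded_bilinear_mult]
  let ?D = "\<lambda>x v. (flat_exp (k + 2) (f x) + - real k * flat_exp (k + 1) (f x)) *
              frechet_derivative f (at x) v"
  show ?case
  proof (rule C_differentiable_on_SucI[OF assms(1)])
    show "((\<lambda>x. flat_exp k (f x)) has_derivative ?D x) (at x)" if "x \<in> S" for x
      using has_derivative_compose[OF C_differentiable_on_SucD[OF Suc.prems that]
          flat_exp_deriv[THEN has_field_derivative_imp_has_derivative], of k]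
      by simp
    have flat: "C_differentiable_on n S (\<lambda>x. flat_exp j (f x))" for j
      by (rule Suc.IH[OF C_differentiable_on_pred[OF Suc.prems]])
    have df: "C_differentiable_on n S (\<lambda>x. frechet_derivative f (at x) v)" for v
      using Suc.prems by simp
    show "C_differentiable_on n S (\<lambda>x. ?D x v)" for v
      by (rule mult[OF C_differentiable_on_add[OF assms(1) flat
          mult[OF C_differentiable_on_const flat]] df])
  qed
qed

section \<open>Smooth functions on manifolds\<close>

lemma smooth_map_onD:
  "smooth_map_on atlas W f \<Longrightarrow> (U, x) \<in> atlas \<Longrightarrow>
   C_differentiable_on n (x ` (U \<inter> W)) (\<lambda>z. f (inv_into U x z))"
  by (auto simp: smooth_map_on_def smooth_on_def comp_def)

lemma smooth_map_onI:
  "(\<And>U x n. (U, x) \<in> atlas \<Longrightarrow> C_differentiable_on n (x ` (U \<inter> W)) (\<lambda>z. f (inv_into U x z))) \<Longrightarrow>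
   smooth_map_on atlas W f"
  by (auto simp: smooth_map_on_def smooth_on_def comp_def)

lemma smooth_map_on_subset:
  assumes "smooth_map_on atlas W f" "V \<subseteq> W"
  shows "smooth_map_on atlas V f"
proof (rule smooth_map_onI)
  fix U x n assume "(U, x) \<in> atlas"
  then show "C_differentiable_on n (x ` (U \<inter> V)) (\<lambda>z. f (inv_into U x z))"
    using assms(2) by (intro C_differentiable_on_subset[OF smooth_map_onD[OF assms(1)]]) auto
qed

lemma smooth_map_on_const: "smooth_map_on atlas W (\<lambda>p. c)"
  by (intro smooth_map_onI C_differentiable_on_const)

lemma smooth_map_on_smooth_function: "f \<in> smooth_functions atlas \<Longrightarrow> smooth_map_on atlas W f"
  unfolding smooth_functions_def using smooth_map_on_subset[OF _ subset_UNIV] by blast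

context smooth_manifold
begin

lemma inv_into_chart: "(U, x) \<in> atlas \<Longrightarrow> p \<in> U \<Longrightarrow> inv_into U x (x p) = p"
  by (rule homeomorphism_apply1[OF chart_homeomorphism])

lemma open_chart_image:
  assumes "(U, x) \<in> atlas" "open W"
  shows "open (x ` (U \<inter> W))"
proof -
  have "openin (top_of_set (x ` U)) (x ` (U \<inter> W))"
    using homeomorphism_imp_open_map[OF chart_homeomorphism[OF assms(1)]] assms(2)
    by (simp add: openin_open_Int)
  then show ?thesis by (rule openin_open_trans) (use chart_open[OF assms(1)] in blast)
qed

lemma chart_at: obtains U x where "(U, x) \<in> atlas" "p \<in> U"
proof -
  have "p \<in> (\<Union>(U, x)\<in>atlas. U)" by (simp add: charts_cover)
  then show ?thesis using that by auto
qed

lemma smooth_map_on_cong: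
  assumes "open W" "\<And>p. p \<in> W \<Longrightarrow> f p = g p" "smooth_map_on atlas W f"
  shows "smooth_map_on atlas W g"
proof (rule smooth_map_onI)
  fix U x n assume "(U, x) \<in> atlas"
  then show "C_differentiable_on n (x ` (U \<inter> W)) (\<lambda>z. g (inv_into U x z))"
    using assms
    by (intro C_differentiable_on_cong[OF open_chart_image _ smooth_map_onD[OF assms(3)]])
       (auto simp: inv_into_chart)
qed

lemma smooth_map_on_local:
  assumes "\<And>p. p \<in> W \<Longrightarrow> \<exists>V. open V \<and> p \<in> V \<and> smooth_map_on atlas V f"
  shows "smooth_map_on atlas W f"
proof (intro smooth_map_onI C_differentiable_on_local)
  fix U x n z assume U: "(U, x) \<in> atlas" and z: "z \<in> x ` (U \<inter> W)"
  then obtain p where p: "p \<in> U" "p \<in> W" "z = x p" by blast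
  then obtain V where V: "open V" "p \<in> V" "smooth_map_on atlas V f"
    using assms by blast
  show "\<exists>T. open T \<and> z \<in> T \<and> C_differentiable_on n T (\<lambda>z. f (inv_into U x z))"
    using open_chart_image[OF U V(1)] smooth_map_onD[OF V(3) U] p V(2) by blast
qed

lemma smooth_map_on_add:
  assumes "open W" "smooth_map_on atlas W f" "smooth_map_on atlas W g"
  shows "smooth_map_on atlas W (\<lambda>p. f p + g p)"
proof (rule smooth_map_onI)
  fix U x n assume U: "(U, x) \<in> atlas"
  show "C_differentiable_on n (x ` (U \<inter> W)) (\<lambda>z. f (inv_into U x z) + g (inv_into U x z))"
    by (rule C_differentiable_on_add[OF open_chart_image[OF U assms(1)]
        smooth_map_onD[OF assms(2) U] smooth_map_onD[OF assms(3) U]])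
qed

lemma smooth_map_on_bilinear:
  assumes "bounded_bilinear B" "open W" "smooth_map_on atlas W f" "smooth_map_on atlas W g"
  shows "smooth_map_on atlas W (\<lambda>p. B (f p) (g p))"
proof (rule smooth_map_onI)
  fix U x n assume U: "(U, x) \<in> atlas"
  show "C_differentiable_on n (x ` (U \<inter> W)) (\<lambda>z. B (f (inv_into U x z)) (g (inv_into U x z)))"
    by (rule C_differentiable_on_bilinear[OF open_chart_image[OF U assms(2)] assms(1)
        smooth_map_onD[OF assms(3) U] smooth_map_onD[OF assms(4) U]])
qed

lemmas smooth_map_on_mult = smooth_map_on_bilinear[OF bounded_bilinear_mult]
  and smooth_map_on_scaleR = smooth_map_on_bilinear[OF bounded_bilinear_scaleR]
  and smooth_map_on_inner = smooth_map_on_bilinear[OF bounded_bilinear_inner]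

lemma smooth_map_on_diff:
  fixes f :: "'m \<Rightarrow> 'b::real_normed_vector"
  assumes "open W" "smooth_map_on atlas W f" "smooth_map_on atlas W g"
  shows "smooth_map_on atlas W (\<lambda>p. f p - g p)"
  using smooth_map_on_add[OF assms(1,2)
      smooth_map_on_scaleR[OF assms(1) smooth_map_on_const[of atlas W "- 1"] assms(3)]]
  by simp

lemma smooth_map_on_sum:
  fixes f :: "'i \<Rightarrow> 'm \<Rightarrow> 'b::real_normed_vector"
  assumes "open W" "\<And>i. i \<in> I \<Longrightarrow> smooth_map_on atlas W (f i)"
  shows "smooth_map_on atlas W (\<lambda>p. \<Sum>i\<in>I. f i p)"
  using assms(2)
proof (induction I rule: infinite_finite_induct)
  case (insert i I)
  then show ?case using smooth_map_on_add[OF assms(1), of "f i" "\<lambda>p. \<Sum>i\<in>I. f i p"] by simp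
qed (simp_all add: smooth_map_on_const)

lemma smooth_map_on_inverse:
  fixes f :: "'m \<Rightarrow> real"
  assumes "open W" "smooth_map_on atlas W f" "\<And>p. p \<in> W \<Longrightarrow> f p \<noteq> 0"
  shows "smooth_map_on atlas W (\<lambda>p. inverse (f p))"
proof (rule smooth_map_onI)
  fix U x n assume U: "(U, x) \<in> atlas"
  show "C_differentiable_on n (x ` (U \<inter> W)) (\<lambda>z. inverse (f (inv_into U x z)))"
    by (rule C_differentiable_on_inverse[OF open_chart_image[OF U assms(1)]
        smooth_map_onD[OF assms(2) U]])
       (use assms(3) U in \<open>auto simp: inv_into_chart\<close>)
qed

lemma smooth_map_on_flat_exp:
  assumes "open W" "smooth_map_on atlas W f"
  shows "smooth_map_on atlas W (\<lambda>p. flat_exp k (f p))"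
proof (rule smooth_map_onI)
  fix U x n assume U: "(U, x) \<in> atlas"
  show "C_differentiable_on n (x ` (U \<inter> W)) (\<lambda>z. flat_exp k (f (inv_into U x z)))"
    by (rule C_differentiable_on_flat_exp[OF open_chart_image[OF U assms(1)]
        smooth_map_onD[OF assms(2) U]])
qed

lemma smooth_map_on_chart:
  assumes "(U, x) \<in> atlas"
  shows "smooth_map_on atlas U x"
proof (rule smooth_map_onI)
  fix V y n assume "(V, y) \<in> atlas"
  from chart_transition[OF this assms]
  show "C_differentiable_on n (y ` (V \<inter> U)) (\<lambda>z. x (inv_into V y z))"
    by (simp add: smooth_on_def comp_def)
qed

lemma smooth_map_on_open_nonzero:
  fixes f :: "'m \<Rightarrow> real"
  assumes "open W" "p \<in> W" "smooth_map_on atlas W f" "f p \<noteq> 0"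
  obtains V where "open V" "p \<in> V" "V \<subseteq> W" "\<And>q. q \<in> V \<Longrightarrow> f q \<noteq> 0"
proof -
  obtain U x where U: "(U, x) \<in> atlas" "p \<in> U" by (rule chart_at)
  have "continuous_on (U \<inter> W) x"
    using homeomorphism_cont1[OF chart_homeomorphism[OF U(1)]] continuous_on_subset by blast
  moreover have "continuous_on (x ` (U \<inter> W)) (\<lambda>z. f (inv_into U x z))"
    using smooth_map_onD[OF assms(3) U(1), of 0] by simp
  ultimately have "continuous_on (U \<inter> W) (\<lambda>q. f (inv_into U x (x q)))"
    using continuous_on_compose2 by blast
  then have "continuous_on (U \<inter> W) f"
    by (rule continuous_on_eq) (simp add: inv_into_chart[OF U(1)])
  moreover have "open (U \<inter> W)" using chart_open[OF U(1)] assms(1) by blast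
  ultimately have "open (f -` (- {0}) \<inter> (U \<inter> W))"
    using continuous_on_open_vimage[of "U \<inter> W" f] by blast
  then show ?thesis using that[of "f -` (- {0}) \<inter> (U \<inter> W)"] U assms by auto
qed

lemma smooth_functions_add:
  "f \<in> smooth_functions atlas \<Longrightarrow> g \<in> smooth_functions atlas \<Longrightarrow> f + g \<in> smooth_functions atlas"
  using smooth_map_on_add[of UNIV f g] by (simp add: smooth_functions_def plus_fun_def)

lemma smooth_functions_mult:
  "f \<in> smooth_functions atlas \<Longrightarrow> g \<in> smooth_functions atlas \<Longrightarrow>
   (\<lambda>p. f p * g p) \<in> smooth_functions atlas"
  using smooth_map_on_mult[of UNIV f g] by (simp add: smooth_functions_def)

lemma smooth_functions_const: "(\<lambda>p. c) \<in> smooth_functions atlas"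
  by (simp add: smooth_functions_def smooth_map_on_const)

text \<open>In a chart \<open>x\<close> around \<open>p\<close> the function \<open>exp (-1/(r\<^sup>2 - |x - x(p)|\<^sup>2))\<close> vanishes outside the ball
  of radius \<open>r\<close>. Its extension by 0 is smooth because the preimage of the closed ball is compact,
  hence closed: this is where the Hausdorff property and the finite dimension enter. The value 1 is
  normalised at \<open>p\<close> alone; objects cut off by \<open>h\<close> are recovered near \<open>p\<close> by dividing by \<open>h\<close>.\<close>

lemma bump_function:
  assumes "open W" "p \<in> W"
  obtains h C where "h \<in> smooth_functions atlas" "h p = 1" "closed C" "C \<subseteq> W"
    "\<And>q. q \<notin> C \<Longrightarrow> h q = 0"
proof -
  obtain U x where U: "(U, x) \<in> atlas" "p \<in> U" by (rule chart_at)
  have "open (x ` (U \<inter> W))" "x p \<in> x ` (U \<inter> W)"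
    using open_chart_image[OF U(1) assms(1)] U assms(2) by auto
  then obtain r where r: "r > 0" "cball (x p) r \<subseteq> x ` (U \<inter> W)"
    using open_contains_cball by blast
  define C where "C = inv_into U x ` cball (x p) r"
  have inv: "z \<in> cball (x p) r \<Longrightarrow> inv_into U x z \<in> U \<inter> W \<and> x (inv_into U x z) = z" for z
    using r(2) inv_into_chart[OF U(1)] by auto
  have "continuous_on (cball (x p) r) (inv_into U x)"
    using homeomorphism_cont2[OF chart_homeomorphism[OF U(1)]] r(2)
    by (auto intro: continuous_on_subset)
  then have "compact C"
    unfolding C_def
    by (intro compact_continuous_image compact_cball_finite_dim[OF model_finite_dim])
  then have closedC: "closed C" by (rule compact_imp_closed)
  have CW: "C \<subseteq> U" "C \<subseteq> W" using inv by (auto simp: C_def)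
  define \<psi> where "\<psi> q = flat_exp 0 (r\<^sup>2 - (x q - x p) \<bullet> (x q - x p))" for q
  define h where "h q = (if q \<in> U then \<psi> q else 0)" for q
  have out: "h q = 0" if "q \<notin> C" for q
  proof (cases "q \<in> U")
    case True
    have "x q \<notin> cball (x p) r"
      using that inv_into_chart[OF U(1) True] by (force simp: C_def)
    then have "r < norm (x q - x p)" by (simp add: dist_norm norm_minus_commute)
    then have "r\<^sup>2 < (norm (x q - x p))\<^sup>2" using r(1) by (intro power_strict_mono) auto
    then show ?thesis using True by (simp add: h_def \<psi>_def flat_exp_def power2_norm_eq_inner)
  qed (simp add: h_def)
  have oU: "open U" using chart_open[OF U(1)] by blast
  have "smooth_map_on atlas U (\<lambda>q. x q - x p)"
    by (intro smooth_map_on_diff oU smooth_map_on_chart U smooth_map_on_const)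
  then have "smooth_map_on atlas U \<psi>"
    unfolding \<psi>_def
    by (intro smooth_map_on_flat_exp smooth_map_on_diff[OF oU smooth_map_on_const]
        smooth_map_on_inner oU)
  then have "smooth_map_on atlas U h"
    by (rule smooth_map_on_cong[OF oU, rotated]) (simp add: h_def)
  moreover have "smooth_map_on atlas (- C) h"
    by (rule smooth_map_on_cong[OF open_Compl[OF closedC] _ smooth_map_on_const[of _ _ 0]])
       (simp add: out)
  ultimately have "\<exists>V. open V \<and> q \<in> V \<and> smooth_map_on atlas V h" for q
    using oU open_Compl[OF closedC] CW by (cases "q \<in> U") blast+
  then have "smooth_map_on atlas UNIV h" by (intro smooth_map_on_local) blast
  then have h: "h \<in> smooth_functions atlas" by (simp add: smooth_functions_def)
  have hp: "h p \<noteq> 0" using r(1) U(2) by (simp add: h_def \<psi>_def flat_exp_def)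
  show ?thesis
  proof
    show "(\<lambda>q. inverse (h p) * h q) \<in> smooth_functions atlas"
      by (rule smooth_functions_mult[OF smooth_functions_const h])
    show "inverse (h p) * h p = 1" using hp by simp
    show "inverse (h p) * h q = 0" if "q \<notin> C" for q using out[OF that] by simp
  qed (rule closedC CW(2))+
qed

text \<open>The product and the zero function are smooth on \<open>U \<inter> V\<close> and on the complement of \<open>C\<close>, which
  together cover \<open>V\<close>.\<close>

lemma smooth_map_on_extend_by_0:
  assumes "open U" "open V" "h \<in> smooth_functions atlas" "closed C" "C \<subseteq> U"
    and "\<And>q. q \<notin> C \<Longrightarrow> h q = 0" "smooth_map_on atlas (U \<inter> V) f"
  shows "smooth_map_on atlas V (\<lambda>q. if q \<in> U then h q *\<^sub>R f q else 0)" (is "smooth_map_on _ _ ?F")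
proof (rule smooth_map_on_local)
  fix q assume q: "q \<in> V"
  have UV: "open (U \<inter> V)" using assms by blast
  have "smooth_map_on atlas (U \<inter> V) (\<lambda>q. h q *\<^sub>R f q)"
    by (rule smooth_map_on_scaleR[OF UV smooth_map_on_smooth_function[OF assms(3)] assms(7)])
  then have "smooth_map_on atlas (U \<inter> V) ?F"
    by (rule smooth_map_on_cong[OF UV, rotated]) simp
  moreover have "smooth_map_on atlas (- C) ?F"
    by (rule smooth_map_on_cong[OF open_Compl[OF assms(4)] _ smooth_map_on_const[of _ _ 0]])
       (simp add: assms(6))
  ultimately show "\<exists>V. open V \<and> q \<in> V \<and> smooth_map_on atlas V ?F"
    using UV open_Compl[OF assms(4)] q assms(5) by (cases "q \<in> U") blast+
qed

text \<open>Instead of inverting a matrix, one unknown at a time is eliminated with a pivot that is nonzero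
  at, hence near, \<open>p\<close>. The system may be overdetermined, so that the pivot equation can be kept in the
  reduced system, where it reads \<open>0 = 0\<close>, and the set of equations stays the same in the induction.\<close>

lemma linear_system_solution_smooth:
  fixes a :: "'i \<Rightarrow> 'j \<Rightarrow> 'm \<Rightarrow> real" and y :: "'j \<Rightarrow> 'm \<Rightarrow> real"
  assumes "finite J" "open W" "p \<in> W"
    and "\<And>i j. smooth_map_on atlas W (a i j)" "\<And>i. smooth_map_on atlas W (b i)"
    and "\<And>i q. q \<in> W \<Longrightarrow> (\<Sum>j\<in>J. a i j q * y j q) = b i q"
    and "\<And>s. (\<And>i. (\<Sum>j\<in>J. a i j p * s j) = 0) \<Longrightarrow> \<forall>j\<in>J. s j = 0"
  shows "\<exists>V. open V \<and> p \<in> V \<and> (\<forall>j\<in>J. smooth_map_on atlas V (y j))"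
  using assms
proof (induction J arbitrary: W a b)
  case empty
  then show ?case by auto
next
  case (insert k J)
  note eqs = insert.prems(5) and ker = insert.prems(6)
  have "\<exists>i. a i k p \<noteq> 0"
  proof (rule ccontr)
    assume "\<not> ?thesis"
    then have "(\<Sum>j\<in>insert k J. a i j p * (if j = k then 1 else 0)) = 0" for i
      by (intro sum.neutral) auto
    from ker[of "\<lambda>j. if j = k then 1 else 0", OF this] show False by auto
  qed
  then obtain i0 where "a i0 k p \<noteq> 0" by blast
  then obtain W' where W': "open W'" "p \<in> W'" "W' \<subseteq> W" "\<And>q. q \<in> W' \<Longrightarrow> a i0 k q \<noteq> 0"
    using smooth_map_on_open_nonzero[OF insert.prems(1,2,3)] by blast
  have a: "smooth_map_on atlas W' (a i j)" and b: "smooth_map_on atlas W' (b i)" for i j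
    using insert.prems(3,4) W'(3) smooth_map_on_subset by blast+
  have piv: "smooth_map_on atlas W' (\<lambda>q. inverse (a i0 k q))"
    by (rule smooth_map_on_inverse[OF W'(1) a W'(4)])
  define m where "m i q = a i k q * inverse (a i0 k q)" for i q
  have m: "smooth_map_on atlas W' (m i)" for i
    unfolding m_def by (rule smooth_map_on_mult[OF W'(1) a piv])
  let ?a = "\<lambda>i j q. a i j q - m i q * a i0 j q"
  let ?b = "\<lambda>i q. b i q - m i q * b i0 q"
  have split: "(\<Sum>j\<in>J. ?a i j q * s j) =
      (\<Sum>j\<in>insert k J. a i j q * s j) - m i q * (\<Sum>j\<in>insert k J. a i0 j q * s j)"
    if "q \<in> W'" for i q s
  proof -
    have "?a i k q = 0" using W'(4)[OF that] by (simp add: m_def)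
    then have "(\<Sum>j\<in>J. ?a i j q * s j) = (\<Sum>j\<in>insert k J. ?a i j q * s j)"
      using insert.hyps by simp
    then show ?thesis
      by (simp only: left_diff_distrib sum_subtractf sum_distrib_left mult.assoc)
  qed
  have "\<exists>V. open V \<and> p \<in> V \<and> (\<forall>j\<in>J. smooth_map_on atlas V (y j))"
  proof (rule insert.IH[OF W'(1,2), of ?a ?b])
    show "smooth_map_on atlas W' (?a i j)" "smooth_map_on atlas W' (?b i)" for i j
      by (intro smooth_map_on_diff smooth_map_on_mult W'(1) a b m)+
    show "(\<Sum>j\<in>J. ?a i j q * y j q) = ?b i q" if "q \<in> W'" for i q
      using split[OF that] eqs[of q] that W'(3) by auto
    show "\<forall>j\<in>J. s j = 0" if s: "\<And>i. (\<Sum>j\<in>J. ?a i j p * s j) = 0" for s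
    proof -
      \<comment> \<open>A kernel vector of the reduced system extends to one of the full system: the coordinate at
        the eliminated unknown is dictated by the pivot equation.\<close>
      define s' where "s' = s(k := - inverse (a i0 k p) * (\<Sum>j\<in>J. a i0 j p * s j))"
      have s'J: "(\<Sum>j\<in>J. c j * s' j) = (\<Sum>j\<in>J. c j * s j)" for c
        using insert.hyps by (intro sum.cong) (auto simp: s'_def)
      have 0: "(\<Sum>j\<in>insert k J. a i0 j p * s' j) = 0"
        using insert.hyps W'(4)[OF W'(2)] s'J[of "\<lambda>j. a i0 j p"] by (simp add: s'_def)
      have "(\<Sum>j\<in>insert k J. a i j p * s' j) = 0" for i
        using split[OF W'(2), of i s'] s[of i] s'J[of "\<lambda>j. ?a i j p"] 0 by simp
      from ker[OF this] show ?thesis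
        using insert.hyps(2) by (metis s'_def fun_upd_other insertCI)
    qed
  qed
  then obtain V where V: "open V" "p \<in> V" "\<And>j. j \<in> J \<Longrightarrow> smooth_map_on atlas V (y j)"
    by blast
  have VW: "open (V \<inter> W')" using V W' by blast
  have sub: "smooth_map_on atlas V f \<Longrightarrow> smooth_map_on atlas (V \<inter> W') f"
    "smooth_map_on atlas W' f \<Longrightarrow> smooth_map_on atlas (V \<inter> W') f" for f :: "'m \<Rightarrow> real"
    by (auto intro: smooth_map_on_subset)
  have "smooth_map_on atlas (V \<inter> W')
      (\<lambda>q. inverse (a i0 k q) * (b i0 q - (\<Sum>j\<in>J. a i0 j q * y j q)))"
    by (intro smooth_map_on_mult smooth_map_on_diff smooth_map_on_sum VW) (auto intro: sub piv a b V)
  then have "smooth_map_on atlas (V \<inter> W') (y k)"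
  proof (rule smooth_map_on_cong[OF VW, rotated])
    fix q assume q: "q \<in> V \<inter> W'"
    then have "a i0 k q * y k q = b i0 q - (\<Sum>j\<in>J. a i0 j q * y j q)"
      using eqs[of q i0] insert.hyps W'(3) by auto
    then show "inverse (a i0 k q) * (b i0 q - (\<Sum>j\<in>J. a i0 j q * y j q)) = y k q"
      using W'(4)[of q] q by (simp add: field_simps)
  qed
  then show ?case using V W' VW sub(1)[OF V(3)] by blast
qed

end

section \<open>Sections and covector fields of vector bundles\<close>

lemma linear_on_sum:
  assumes "linear_on V f" "subspace V" "\<And>i. i \<in> I \<Longrightarrow> u i \<in> V"
  shows "f (\<Sum>i\<in>I. c i *\<^sub>R u i) = (\<Sum>i\<in>I. c i *\<^sub>R f (u i))"
  using assms(3)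
proof (induction I rule: infinite_finite_induct)
  case (insert i I)
  have "(\<Sum>i\<in>I. c i *\<^sub>R u i) \<in> V"
    using insert by (intro subspace_sum[OF assms(2)] subspace_scale[OF assms(2)]) auto
  moreover have "c i *\<^sub>R u i \<in> V" using insert by (intro subspace_scale[OF assms(2)]) auto
  ultimately show ?case using assms(1) insert by (simp add: linear_on_def)
next
  case empty
  have "f (0 *\<^sub>R 0) = 0 *\<^sub>R f 0"
    using assms(1) subspace_0[OF assms(2)] unfolding linear_on_def by blast
  then show ?case by simp
next
  case (infinite I)
  have "f (0 *\<^sub>R 0) = 0 *\<^sub>R f 0"
    using assms(1) subspace_0[OF assms(2)] unfolding linear_on_def by blast
  then show ?case using infinite by simp
qed

lemma linear_on_0:
  assumes "linear_on V f" "subspace V"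
  shows "f 0 = 0"
  using linear_on_sum[OF assms, of "{}"] by simp

context vector_bundle
begin

lemmas onb_fibre = finite_onb[OF fibre_model_finite_dim] onb_expansion[OF fibre_model_finite_dim]

lemma triv_at: obtains U \<phi> where "(U, \<phi>) \<in> trivs E" "p \<in> U"
proof -
  have "p \<in> (\<Union>(U, \<phi>)\<in>trivs E. U)" by (simp add: trivs_cover)
  then show ?thesis using that by auto
qed

lemma
  assumes "(U, \<phi>) \<in> trivs E" "p \<in> U"
  shows triv_linear: "linear_on (fibre E p) (\<phi> p)"
    and triv_inv_fibre: "triv_inv E \<phi> p c \<in> fibre E p"
    and triv_triv_inv: "\<phi> p (triv_inv E \<phi> p c) = c"
    and triv_inv_triv: "v \<in> fibre E p \<Longrightarrow> triv_inv E \<phi> p (\<phi> p v) = v"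
proof -
  have b: "linear_on (fibre E p) (\<phi> p)" "inj_on (\<phi> p) (fibre E p)" "\<phi> p ` fibre E p = UNIV"
    using triv_iso[OF assms] by (auto simp: bij_betw_def)
  then show "linear_on (fibre E p) (\<phi> p)" by blast
  show "triv_inv E \<phi> p c \<in> fibre E p" unfolding triv_inv_def by (rule inv_into_into) (simp add: b)
  show "\<phi> p (triv_inv E \<phi> p c) = c" unfolding triv_inv_def by (rule f_inv_into_f) (simp add: b)
  show "v \<in> fibre E p \<Longrightarrow> triv_inv E \<phi> p (\<phi> p v) = v"
    unfolding triv_inv_def by (rule inv_into_f_f[OF b(2)])
qed

lemma triv_frame_sum:
  assumes "(U, \<phi>) \<in> trivs E" "p \<in> U"
  shows "(\<Sum>b\<in>onb. s b *\<^sub>R triv_inv E \<phi> p b) = triv_inv E \<phi> p (\<Sum>b\<in>onb. s b *\<^sub>R b)"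
proof -
  let ?v = "\<Sum>b\<in>onb. s b *\<^sub>R triv_inv E \<phi> p b"
  have "?v \<in> fibre E p"
    by (intro subspace_sum subspace_scale fibre_subspace triv_inv_fibre[OF assms])
  moreover have "\<phi> p ?v = (\<Sum>b\<in>onb. s b *\<^sub>R b)"
    using linear_on_sum[OF triv_linear[OF assms] fibre_subspace triv_inv_fibre[OF assms], of s]
    by (simp add: triv_triv_inv[OF assms])
  ultimately show ?thesis using triv_inv_triv[OF assms] by metis
qed

lemma triv_frame_expansion:
  assumes "(U, \<phi>) \<in> trivs E" "p \<in> U" "v \<in> fibre E p"
  shows "(\<Sum>b\<in>onb. (\<phi> p v \<bullet> b) *\<^sub>R triv_inv E \<phi> p b) = v"
  by (simp add: triv_frame_sum[OF assms(1,2)] onb_fibre triv_inv_triv[OF assms])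

lemma linear_form_frame_expansion:
  assumes "(U, \<phi>) \<in> trivs E" "p \<in> U" "v \<in> fibre E p" "linear_on (fibre E p) l"
  shows "l v = (\<Sum>b\<in>onb. (\<phi> p v \<bullet> b) *\<^sub>R l (triv_inv E \<phi> p b))"
  using linear_on_sum[OF assms(4) fibre_subspace triv_inv_fibre[OF assms(1,2)],
      of "\<lambda>b. \<phi> p v \<bullet> b" "\<lambda>b. b" onb]
  by (simp add: triv_frame_expansion[OF assms(1-3)])

lemma section_fibre: "X \<in> sections atlas E \<Longrightarrow> X p \<in> fibre E p"
  by (simp add: sections_def)

lemma section_smooth:
  "X \<in> sections atlas E \<Longrightarrow> (U, \<phi>) \<in> trivs E \<Longrightarrow> smooth_map_on atlas U (\<lambda>p. \<phi> p (X p))"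
  unfolding sections_def by blast

lemma sectionI:
  "(\<And>p. X p \<in> fibre E p) \<Longrightarrow>
   (\<And>U \<phi>. (U, \<phi>) \<in> trivs E \<Longrightarrow> smooth_map_on atlas U (\<lambda>p. \<phi> p (X p))) \<Longrightarrow> X \<in> sections atlas E"
  unfolding sections_def by blast

lemma section_component_smooth:
  assumes "X \<in> sections atlas E" "(U, \<phi>) \<in> trivs E"
  shows "smooth_map_on atlas U (\<lambda>p. \<phi> p (X p) \<bullet> c)"
  by (rule smooth_map_on_inner[OF triv_open[OF assms(2)] section_smooth[OF assms]
      smooth_map_on_const])

text \<open>The coefficients of \<open>X\<close> in the local frame are smooth and the forms are fibrewise linear.\<close>

lemma linear_forms_smooth_on_section:
  assumes "(U, \<phi>) \<in> trivs E" "\<And>p. p \<in> U \<Longrightarrow> linear_on (fibre E p) (l p)"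
    and "\<And>c. smooth_map_on atlas U (\<lambda>p. l p (triv_inv E \<phi> p c))" "X \<in> sections atlas E"
  shows "smooth_map_on atlas U (\<lambda>p. l p (X p) :: real)"
proof (rule smooth_map_on_cong[OF triv_open[OF assms(1)]])
  show "(\<Sum>b\<in>onb. (\<phi> p (X p) \<bullet> b) *\<^sub>R l p (triv_inv E \<phi> p b)) = l p (X p)" if "p \<in> U" for p
    using linear_form_frame_expansion[OF assms(1) that section_fibre[OF assms(4)] assms(2)[OF that]]
    by simp
  show "smooth_map_on atlas U (\<lambda>p. \<Sum>b\<in>onb. (\<phi> p (X p) \<bullet> b) *\<^sub>R l p (triv_inv E \<phi> p b))"
    by (intro smooth_map_on_sum triv_open[OF assms(1)]
        smooth_map_on_scaleR[OF triv_open[OF assms(1)] section_component_smooth[OF assms(4,1)] assms(3)])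
qed

lemma smooth_function_if_smooth_on_trivs:
  assumes "\<And>U \<phi>. (U, \<phi>) \<in> trivs E \<Longrightarrow> smooth_map_on atlas U f"
  shows "f \<in> smooth_functions atlas"
proof -
  have "smooth_map_on atlas UNIV f"
  proof (rule smooth_map_on_local)
    fix p
    obtain U \<phi> where "(U, \<phi>) \<in> trivs E" "p \<in> U" by (rule triv_at)
    then show "\<exists>V. open V \<and> p \<in> V \<and> smooth_map_on atlas V f"
      using assms triv_open by blast
  qed
  then show ?thesis by (simp add: smooth_functions_def)
qed

lemma section_add:
  assumes X: "X \<in> sections atlas E" and Y: "Y \<in> sections atlas E"
  shows "X + Y \<in> sections atlas E"
proof (rule sectionI)
  show "(X + Y) p \<in> fibre E p" for p
    using X Y by (simp add: section_fibre subspace_add[OF fibre_subspace])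
  fix U \<phi> assume U: "(U, \<phi>) \<in> trivs E"
  show "smooth_map_on atlas U (\<lambda>p. \<phi> p ((X + Y) p))"
  proof (rule smooth_map_on_cong[OF triv_open[OF U]])
    show "smooth_map_on atlas U (\<lambda>p. \<phi> p (X p) + \<phi> p (Y p))"
      by (rule smooth_map_on_add[OF triv_open[OF U] section_smooth[OF X U] section_smooth[OF Y U]])
    show "\<phi> p (X p) + \<phi> p (Y p) = \<phi> p ((X + Y) p)" if "p \<in> U" for p
      using triv_linear[OF U that] X Y by (simp add: linear_on_def section_fibre)
  qed
qed

lemma section_scaleR:
  assumes f: "f \<in> smooth_functions atlas" and X: "X \<in> sections atlas E"
  shows "(\<lambda>p. f p *\<^sub>R X p) \<in> sections atlas E"
proof (rule sectionI)
  show "f p *\<^sub>R X p \<in> fibre E p" for p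
    using X by (simp add: section_fibre subspace_scale[OF fibre_subspace])
  fix U \<phi> assume U: "(U, \<phi>) \<in> trivs E"
  show "smooth_map_on atlas U (\<lambda>p. \<phi> p (f p *\<^sub>R X p))"
  proof (rule smooth_map_on_cong[OF triv_open[OF U]])
    show "smooth_map_on atlas U (\<lambda>p. f p *\<^sub>R \<phi> p (X p))"
      by (rule smooth_map_on_scaleR[OF triv_open[OF U] smooth_map_on_smooth_function[OF f]
          section_smooth[OF X U]])
    show "f p *\<^sub>R \<phi> p (X p) = \<phi> p (f p *\<^sub>R X p)" if "p \<in> U" for p
      using triv_linear[OF U that] X by (simp add: linear_on_def section_fibre)
  qed
qed

lemma section_const_scaleR: "X \<in> sections atlas E \<Longrightarrow> c *\<^sub>R X \<in> sections atlas E"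
  using section_scaleR[OF smooth_functions_const[of c]] by (simp add: scaleR_fun_def)

lemma section_0: "0 \<in> sections atlas E"
proof (rule sectionI)
  show "0 p \<in> fibre E p" for p by (simp add: subspace_0[OF fibre_subspace])
  fix U \<phi> assume U: "(U, \<phi>) \<in> trivs E"
  show "smooth_map_on atlas U (\<lambda>p. \<phi> p (0 p))"
    by (rule smooth_map_on_cong[OF triv_open[OF U] _ smooth_map_on_const[of _ _ 0]])
       (simp add: linear_on_0[OF triv_linear[OF U] fibre_subspace])
qed

text \<open>Brackets only apply to global sections; these sections stand in for the local frame fields.\<close>

lemma cut_off_frame_section:
  assumes U: "(U, \<phi>) \<in> trivs E" and h: "h \<in> smooth_functions atlas"
    and C: "closed C" "C \<subseteq> U" "\<And>q. q \<notin> C \<Longrightarrow> h q = 0"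
  shows "(\<lambda>q. if q \<in> U then h q *\<^sub>R triv_inv E \<phi> q c else 0) \<in> sections atlas E"
    (is "?X \<in> _")
proof (rule sectionI)
  show "?X q \<in> fibre E q" for q
    by (simp add: subspace_0[OF fibre_subspace] subspace_scale[OF fibre_subspace] triv_inv_fibre[OF U])
  fix V \<psi> assume V: "(V, \<psi>) \<in> trivs E"
  show "smooth_map_on atlas V (\<lambda>q. \<psi> q (?X q))"
  proof (rule smooth_map_on_cong[OF triv_open[OF V]])
    show "smooth_map_on atlas V (\<lambda>q. if q \<in> U then h q *\<^sub>R \<psi> q (triv_inv E \<phi> q c) else 0)"
      by (rule smooth_map_on_extend_by_0[OF triv_open[OF U] triv_open[OF V] h C
          triv_transition[OF U V]])
    show "(if q \<in> U then h q *\<^sub>R \<psi> q (triv_inv E \<phi> q c) else 0) = \<psi> q (?X q)" if "q \<in> V" for q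
      using triv_linear[OF V that] triv_inv_fibre[OF U]
        linear_on_0[OF triv_linear[OF V that] fibre_subspace]
      by (simp add: linear_on_def)
  qed
qed

lemma section_through:
  assumes "v \<in> fibre E p"
  obtains X where "X \<in> sections atlas E" "X p = v"
proof -
  obtain U \<phi> where U: "(U, \<phi>) \<in> trivs E" "p \<in> U" by (rule triv_at)
  obtain h C where h: "h \<in> smooth_functions atlas" "h p = 1" "closed C" "C \<subseteq> U"
      "\<And>q. q \<notin> C \<Longrightarrow> h q = 0"
    using bump_function[OF triv_open[OF U(1)] U(2)] by blast
  show ?thesis
  proof
    show "(\<lambda>q. if q \<in> U then h q *\<^sub>R triv_inv E \<phi> q (\<phi> p v) else 0) \<in> sections atlas E"
      by (rule cut_off_frame_section[OF U(1) h(1,3,4,5)])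
    show "(if p \<in> U then h p *\<^sub>R triv_inv E \<phi> p (\<phi> p v) else 0) = v"
      using U h(2) triv_inv_triv[OF U assms] by simp
  qed
qed

lemma covector_fieldI:
  assumes "\<And>p. linear_on (fibre E p) (\<omega> p)" "\<And>p v. v \<notin> fibre E p \<Longrightarrow> \<omega> p v = 0"
    and "\<And>U \<phi> c. (U, \<phi>) \<in> trivs E \<Longrightarrow> smooth_map_on atlas U (\<lambda>p. \<omega> p (triv_inv E \<phi> p c))"
  shows "\<omega> \<in> covector_fields atlas E"
  unfolding covector_fields_def using assms by blast

lemma
  assumes "\<omega> \<in> covector_fields atlas E"
  shows covector_linear: "linear_on (fibre E p) (\<omega> p)"
    and covector_outside: "v \<notin> fibre E p \<Longrightarrow> \<omega> p v = 0"
    and covector_smooth: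
      "(U, \<phi>) \<in> trivs E \<Longrightarrow> smooth_map_on atlas U (\<lambda>p. \<omega> p (triv_inv E \<phi> p c))"
  using assms unfolding covector_fields_def by blast+

lemma pairing_smooth:
  assumes "\<omega> \<in> covector_fields atlas E" "X \<in> sections atlas E"
  shows "pairing \<omega> X \<in> smooth_functions atlas"
  unfolding pairing_def
  by (rule smooth_function_if_smooth_on_trivs, rule linear_forms_smooth_on_section)
     (use assms in \<open>auto intro: covector_linear covector_smooth\<close>)

lemma covector_field_eqI:
  assumes "\<omega> \<in> covector_fields atlas E" "\<eta> \<in> covector_fields atlas E"
    and "\<And>Y. Y \<in> sections atlas E \<Longrightarrow> pairing \<omega> Y = pairing \<eta> Y"
  shows "\<omega> = \<eta>"
proof (intro ext)
  fix p v
  show "\<omega> p v = \<eta> p v"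
  proof (cases "v \<in> fibre E p")
    case True
    then obtain Y where Y: "Y \<in> sections atlas E" "Y p = v" by (rule section_through)
    show ?thesis using fun_cong[OF assms(3)[OF Y(1)], of p] Y(2) by (simp add: pairing_def)
  qed (simp add: covector_outside[OF assms(1)] covector_outside[OF assms(2)])
qed

lemma covector_add:
  assumes "\<omega> \<in> covector_fields atlas E" "\<eta> \<in> covector_fields atlas E"
  shows "\<omega> + \<eta> \<in> covector_fields atlas E"
proof (rule covector_fieldI)
  show "linear_on (fibre E p) ((\<omega> + \<eta>) p)" for p
    using covector_linear[OF assms(1), of p] covector_linear[OF assms(2), of p]
    by (simp add: linear_on_def algebra_simps)
  show "(\<omega> + \<eta>) p v = 0" if "v \<notin> fibre E p" for p v
    using that by (simp add: covector_outside[OF assms(1)] covector_outside[OF assms(2)])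
  show "smooth_map_on atlas U (\<lambda>p. (\<omega> + \<eta>) p (triv_inv E \<phi> p c))" if "(U, \<phi>) \<in> trivs E" for U \<phi> c
    using smooth_map_on_add[OF triv_open[OF that] covector_smooth[OF assms(1) that]
        covector_smooth[OF assms(2) that]] by simp
qed

lemma covector_diff:
  assumes "\<omega> \<in> covector_fields atlas E" "\<eta> \<in> covector_fields atlas E"
  shows "\<omega> - \<eta> \<in> covector_fields atlas E"
proof (rule covector_fieldI)
  show "linear_on (fibre E p) ((\<omega> - \<eta>) p)" for p
    using covector_linear[OF assms(1), of p] covector_linear[OF assms(2), of p]
    by (simp add: linear_on_def algebra_simps)
  show "(\<omega> - \<eta>) p v = 0" if "v \<notin> fibre E p" for p v
    using that by (simp add: covector_outside[OF assms(1)] covector_outside[OF assms(2)])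
  show "smooth_map_on atlas U (\<lambda>p. (\<omega> - \<eta>) p (triv_inv E \<phi> p c))" if "(U, \<phi>) \<in> trivs E" for U \<phi> c
    using smooth_map_on_diff[OF triv_open[OF that] covector_smooth[OF assms(1) that]
        covector_smooth[OF assms(2) that]] by simp
qed

text \<open>The values at \<open>p\<close> of a \<open>C\<^sup>\<infinity>(M)\<close>-linear map \<open>L\<close> only depend on the argument at \<open>p\<close>: if \<open>h\<close> is a
  bump function around \<open>p\<close> in the domain of a local frame \<open>e\<^sub>b\<close> and \<open>Y = \<Sum> y\<^sub>b e\<^sub>b\<close> there, then
  \<open>h\<^sup>2 Y = \<Sum> (h y\<^sub>b) (h e\<^sub>b)\<close> is a global identity between sections, and applying \<open>L\<close> at \<open>p\<close> gives
  \<open>L(Y)(p) = \<Sum> y\<^sub>b(p) L(h e\<^sub>b)(p)\<close>.\<close>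

lemma tensorial_vanishes:
  assumes add: "\<And>Y Z. Y \<in> sections atlas E \<Longrightarrow> Z \<in> sections atlas E \<Longrightarrow> L (Y + Z) = L Y + L Z"
    and mult: "\<And>f Y. f \<in> smooth_functions atlas \<Longrightarrow> Y \<in> sections atlas E \<Longrightarrow>
      L (\<lambda>p. f p *\<^sub>R Y p) = (\<lambda>p. f p * L Y p)"
    and Y: "Y \<in> sections atlas E" "Y p = 0"
  shows "L Y p = (0::real)"
proof -
  have sum: "(\<lambda>q. \<Sum>b\<in>B. f b q *\<^sub>R Z b q) \<in> sections atlas E \<and>
      L (\<lambda>q. \<Sum>b\<in>B. f b q *\<^sub>R Z b q) p = (\<Sum>b\<in>B. f b p * L (Z b) p)"
    if "\<And>b. b \<in> B \<Longrightarrow> f b \<in> smooth_functions atlas" "\<And>b. b \<in> B \<Longrightarrow> Z b \<in> sections atlas E"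
      "finite B" for B :: "'k set" and f Z
    using that(3,1,2)
  proof (induction B)
    case empty
    have "L 0 p = 0"
      using mult[OF smooth_functions_const[of 0] section_0] by (simp add: zero_fun_def)
    then show ?case using section_0 by (simp add: zero_fun_def)
  next
    case (insert b B)
    have s: "(\<lambda>q. f b q *\<^sub>R Z b q) \<in> sections atlas E"
      using insert.prems by (intro section_scaleR) auto
    have eq: "(\<lambda>q. \<Sum>b\<in>insert b B. f b q *\<^sub>R Z b q) =
        (\<lambda>q. f b q *\<^sub>R Z b q) + (\<lambda>q. \<Sum>b\<in>B. f b q *\<^sub>R Z b q)"
      using insert.hyps by (simp add: fun_eq_iff)
    show ?case
      unfolding eq using insert s
      by (simp add: section_add add mult)
  qed
  obtain U \<phi> where U: "(U, \<phi>) \<in> trivs E" "p \<in> U" by (rule triv_at)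
  obtain h C where h: "h \<in> smooth_functions atlas" "h p = 1"
    and C: "closed C" "C \<subseteq> U" "\<And>q. q \<notin> C \<Longrightarrow> h q = 0"
    using bump_function[OF triv_open[OF U(1)] U(2)] by blast
  define e where "e b q = (if q \<in> U then h q *\<^sub>R triv_inv E \<phi> q b else 0)" for b q
  define y where "y b q = (if q \<in> U then h q *\<^sub>R (\<phi> q (Y q) \<bullet> b) else 0)" for b q
  have e: "e b \<in> sections atlas E" for b
    unfolding e_def by (rule cut_off_frame_section[OF U(1) h(1) C])
  have y: "y b \<in> smooth_functions atlas" for b
  proof -
    have "smooth_map_on atlas (U \<inter> UNIV) (\<lambda>q. \<phi> q (Y q) \<bullet> b)"
      using section_component_smooth[OF Y(1) U(1)] by simp
    from smooth_map_on_extend_by_0[OF triv_open[OF U(1)] open_UNIV h(1) C this]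
    show ?thesis by (simp add: y_def[abs_def] smooth_functions_def)
  qed
  have "(\<Sum>b\<in>onb. y b q *\<^sub>R e b q) = (h q * h q) *\<^sub>R Y q" for q
  proof (cases "q \<in> U")
    case True
    have "(\<Sum>b\<in>onb. y b q *\<^sub>R e b q) =
        (h q * h q) *\<^sub>R (\<Sum>b\<in>onb. (\<phi> q (Y q) \<bullet> b) *\<^sub>R triv_inv E \<phi> q b)"
      using True by (simp add: y_def e_def scaleR_sum_right mult_ac)
    then show ?thesis
      by (simp add: triv_frame_expansion[OF U(1) True section_fibre[OF Y(1)]])
  next
    case False
    then show ?thesis using C by (auto simp: y_def)
  qed
  then have "L (\<lambda>q. (h q * h q) *\<^sub>R Y q) p = (\<Sum>b\<in>onb. y b p * L (e b) p)"
    using sum[of onb y e] y e onb_fibre(1) by simp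
  moreover have "L (\<lambda>q. (h q * h q) *\<^sub>R Y q) p = L Y p"
    using mult[OF smooth_functions_mult[OF h(1) h(1)] Y(1)] h(2) by simp
  moreover have "y b p = 0" for b
    using Y(2) linear_on_0[OF triv_linear[OF U] fibre_subspace] by (simp add: y_def)
  ultimately show ?thesis by simp
qed

text \<open>The covector at \<open>p\<close> is evaluated on \<open>v\<close> by applying \<open>L\<close> to any section through \<open>v\<close>. For
  smoothness the sections can be chosen uniformly near a point, as cut-off frame fields.\<close>

lemma covector_field_of_tensorial:
  assumes smooth: "\<And>Y. Y \<in> sections atlas E \<Longrightarrow> L Y \<in> smooth_functions atlas"
    and add: "\<And>Y Z. Y \<in> sections atlas E \<Longrightarrow> Z \<in> sections atlas E \<Longrightarrow> L (Y + Z) = L Y + L Z"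
    and mult: "\<And>f Y. f \<in> smooth_functions atlas \<Longrightarrow> Y \<in> sections atlas E \<Longrightarrow>
      L (\<lambda>p. f p *\<^sub>R Y p) = (\<lambda>p. f p * L Y p)"
  shows "\<exists>!\<eta>. \<eta> \<in> covector_fields atlas E \<and> (\<forall>Y\<in>sections atlas E. pairing \<eta> Y = L Y)"
proof -
  have cmult: "L (c *\<^sub>R Y) p = c * L Y p" if "Y \<in> sections atlas E" for c Y p
    using mult[OF smooth_functions_const that] by (simp add: scaleR_fun_def)
  have local: "L Y p = L Z p" if YZ: "Y \<in> sections atlas E" "Z \<in> sections atlas E" "Y p = Z p" for Y Z p
  proof -
    define N where "N = (- 1) *\<^sub>R Z"
    have N: "N \<in> sections atlas E" "L N p = - L Z p"
      using section_const_scaleR[OF YZ(2), of "-1"] cmult[OF YZ(2), of "-1" p]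
      by (simp_all only: N_def)
    have "(Y + N) p = 0" using YZ(3) by (simp add: N_def scaleR_fun_def)
    then have "L (Y + N) p = 0"
      using tensorial_vanishes[of L, OF add mult section_add[OF YZ(1) N(1)]] by simp
    then show ?thesis using N(2) by (simp add: add[OF YZ(1) N(1)])
  qed
  define ext where "ext p v = (SOME X. X \<in> sections atlas E \<and> X p = v)" for p v
  have ext: "ext p v \<in> sections atlas E" "ext p v p = v" if "v \<in> fibre E p" for p v
    using section_through[OF that] someI_ex[of "\<lambda>X. X \<in> sections atlas E \<and> X p = v"]
    unfolding ext_def by metis+
  define \<eta> where "\<eta> p v = (if v \<in> fibre E p then L (ext p v) p else 0)" for p v
  have pair: "\<eta> p (Y p) = L Y p" if "Y \<in> sections atlas E" for Y p
    using local[OF ext(1) that, of "Y p" p] ext(2) section_fibre[OF that] by (simp add: \<eta>_def)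
  have "\<eta> \<in> covector_fields atlas E"
  proof (rule covector_fieldI)
    show "linear_on (fibre E p) (\<eta> p)" for p
      unfolding linear_on_def
    proof (intro conjI ballI allI)
      fix u v assume uv: "u \<in> fibre E p" "v \<in> fibre E p"
      show "\<eta> p (u + v) = \<eta> p u + \<eta> p v"
        using pair[OF section_add[OF ext(1)[OF uv(1)] ext(1)[OF uv(2)]], of p]
          pair[OF ext(1)[OF uv(1)], of p] pair[OF ext(1)[OF uv(2)], of p] uv
        by (simp add: ext add)
    next
      fix c v assume v: "v \<in> fibre E p"
      show "\<eta> p (c *\<^sub>R v) = c *\<^sub>R \<eta> p v"
        using pair[OF section_const_scaleR[OF ext(1)[OF v], of c], of p] pair[OF ext(1)[OF v], of p]
          cmult[OF ext(1)[OF v]] v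
        by (simp add: ext scaleR_fun_def)
    qed
    show "\<eta> p v = 0" if "v \<notin> fibre E p" for p v using that by (simp add: \<eta>_def)
    fix U \<phi> c assume U: "(U, \<phi>) \<in> trivs E"
    show "smooth_map_on atlas U (\<lambda>p. \<eta> p (triv_inv E \<phi> p c))"
    proof (rule smooth_map_on_local)
      fix p assume p: "p \<in> U"
      obtain h C where h: "h \<in> smooth_functions atlas" "h p = 1"
        and C: "closed C" "C \<subseteq> U" "\<And>q. q \<notin> C \<Longrightarrow> h q = 0"
        using bump_function[OF triv_open[OF U] p] by blast
      let ?X = "\<lambda>q. if q \<in> U then h q *\<^sub>R triv_inv E \<phi> q c else 0"
      have X: "?X \<in> sections atlas E" by (rule cut_off_frame_section[OF U h(1) C])
      have "h p \<noteq> 0" using h(2) by simp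
      then obtain V where V: "open V" "p \<in> V" "V \<subseteq> U" "\<And>q. q \<in> V \<Longrightarrow> h q \<noteq> 0"
        using smooth_map_on_open_nonzero[OF triv_open[OF U] p smooth_map_on_smooth_function[OF h(1)]]
        by blast
      \<comment> \<open>On \<open>V\<close> the cut-off is undone by dividing by \<open>h\<close>.\<close>
      have "inverse (h q) * L ?X q = \<eta> q (triv_inv E \<phi> q c)" if q: "q \<in> V" for q
      proof -
        have "q \<in> U" using q V(3) by blast
        have t: "triv_inv E \<phi> q c \<in> fibre E q" by (rule triv_inv_fibre[OF U \<open>q \<in> U\<close>])
        have "L ?X q = L (h q *\<^sub>R ext q (triv_inv E \<phi> q c)) q"
          by (rule local[OF X section_const_scaleR[OF ext(1)[OF t]]])
             (simp add: \<open>q \<in> U\<close> ext(2)[OF t] scaleR_fun_def)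
        then show ?thesis using V(4)[OF q] t by (simp add: cmult[OF ext(1)[OF t]] \<eta>_def)
      qed
      moreover have "smooth_map_on atlas V (\<lambda>q. inverse (h q) * L ?X q)"
        by (rule smooth_map_on_mult[OF V(1) smooth_map_on_inverse[OF V(1)
            smooth_map_on_smooth_function[OF h(1)] V(4)] smooth_map_on_smooth_function[OF smooth[OF X]]])
      ultimately have "smooth_map_on atlas V (\<lambda>p. \<eta> p (triv_inv E \<phi> p c))"
        by (rule smooth_map_on_cong[OF V(1)])
      then show "\<exists>V. open V \<and> p \<in> V \<and> smooth_map_on atlas V (\<lambda>p. \<eta> p (triv_inv E \<phi> p c))"
        using V by blast
    qed
  qed
  moreover have "\<forall>Y\<in>sections atlas E. pairing \<eta> Y = L Y"
    using pair by (simp add: pairing_def fun_eq_iff)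
  ultimately show ?thesis by (intro ex1I[of _ \<eta>] conjI) (auto intro: covector_field_eqI)
qed

end

section \<open>Pseudo-Riemannian metrics\<close>

text \<open>With an orthogonal spanning set in place of \<open>B\<close>, the projection is the sum of the components of
  \<open>x\<close>. A zero vector in that set contributes nothing, as division by 0 yields 0.\<close>

lemma orthogonal_projection_exists:
  fixes B :: "'a::real_inner set"
  assumes "finite B"
  shows "\<exists>s\<in>span B. \<forall>y\<in>span B. (x - s) \<bullet> y = 0"
proof -
  obtain C :: "'a set" where C: "finite C" "span C = span B" "pairwise orthogonal C"
    using basis_orthogonal[OF assms] by blast
  let ?s = "\<Sum>c\<in>C. (x \<bullet> c / (c \<bullet> c)) *\<^sub>R c"
  have "(x - ?s) \<bullet> d = 0" if d: "d \<in> C" for d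
  proof -
    have "?s \<bullet> d = (\<Sum>c\<in>C. if c = d then x \<bullet> c else 0)"
      unfolding inner_sum_left using C(3) d
      by (intro sum.cong) (auto simp: pairwise_def orthogonal_def)
    then show ?thesis using C(1) d by (simp add: inner_diff_left)
  qed
  then have "span C \<subseteq> {y. (x - ?s) \<bullet> y = 0}"
    by (intro span_minimal) (auto simp: subspace_hyperplane)
  moreover have "?s \<in> span C" by (intro span_sum span_scale span_base)
  ultimately show ?thesis unfolding C(2) by blast
qed

locale metric_bundle = vector_bundle atlas E
  for atlas :: "('m::{t2_space, second_countable_topology}, 'e::real_inner) atlas"
    and E :: "('m, 'v::real_vector, 'k::real_inner) vbundle" +
  fixes g :: "'m \<Rightarrow> 'v \<Rightarrow> 'v \<Rightarrow> real"
  assumes metric: "pseudo_riemannian_metric atlas E g"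
begin

lemma
  shows metric_linear: "v \<in> fibre E p \<Longrightarrow> linear_on (fibre E p) (g p v)"
    and metric_sym: "v \<in> fibre E p \<Longrightarrow> w \<in> fibre E p \<Longrightarrow> g p v w = g p w v"
    and metric_smooth: "(U, \<phi>) \<in> trivs E \<Longrightarrow>
      smooth_map_on atlas U (\<lambda>p. g p (triv_inv E \<phi> p c) (triv_inv E \<phi> p d))"
    and metric_nondegenerate:
      "v \<in> fibre E p \<Longrightarrow> (\<And>w. w \<in> fibre E p \<Longrightarrow> g p v w = 0) \<Longrightarrow> v = 0"
  using metric unfolding pseudo_riemannian_metric_def by (simp_all, fastforce)

lemma metric_linear_left:
  assumes "w \<in> fibre E p"
  shows "linear_on (fibre E p) (\<lambda>v. g p v w)"
  using metric_linear[OF assms] metric_sym[OF assms] subspace_add[OF fibre_subspace]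
    subspace_scale[OF fibre_subspace]
  by (simp add: linear_on_def)

lemma metric_eqI:
  assumes "u \<in> fibre E p" "v \<in> fibre E p" "\<And>w. w \<in> fibre E p \<Longrightarrow> g p u w = g p v w"
  shows "u = v"
proof -
  have "u + (- 1) *\<^sub>R v = 0"
  proof (rule metric_nondegenerate)
    have v: "(- 1) *\<^sub>R v \<in> fibre E p" using assms(2) by (rule subspace_scale[OF fibre_subspace])
    show "u + (- 1) *\<^sub>R v \<in> fibre E p" by (rule subspace_add[OF fibre_subspace assms(1) v])
    fix w assume w: "w \<in> fibre E p"
    have "g p (u + (- 1) *\<^sub>R v) w = g p u w + g p ((- 1) *\<^sub>R v) w"
      using metric_linear_left[OF w] assms(1) v unfolding linear_on_def by blast
    also have "g p ((- 1) *\<^sub>R v) w = (- 1) *\<^sub>R g p v w"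
      using metric_linear_left[OF w] assms(2) unfolding linear_on_def by blast
    finally show "g p (u + (- 1) *\<^sub>R v) w = 0" using assms(3)[OF w] by simp
  qed
  then show ?thesis by simp
qed

text \<open>Surjectivity of \<open>\<flat>\<close> on a fibre. In a trivialisation the metric becomes a symmetric operator
  \<open>T\<close> on the model space. A vector orthogonal to the range of \<open>T\<close> represents a degenerate direction
  of the metric, so it vanishes and \<open>T\<close> is onto.\<close>

lemma metric_represents:
  assumes l: "linear_on (fibre E p) l"
  shows "\<exists>!v. v \<in> fibre E p \<and> (\<forall>w\<in>fibre E p. g p v w = l w)"
proof -
  obtain U \<phi> where U: "(U, \<phi>) \<in> trivs E" "p \<in> U" by (rule triv_at)
  let ?i = "triv_inv E \<phi> p"
  note i = triv_inv_fibre[OF U] and fin = onb_fibre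
  have add_i: "?i (c + d) = ?i c + ?i d" and scale_i: "?i (r *\<^sub>R c) = r *\<^sub>R ?i c" for c d r
  proof -
    have "\<phi> p (?i c + ?i d) = c + d" "\<phi> p (r *\<^sub>R ?i c) = r *\<^sub>R c"
      using triv_linear[OF U] i triv_triv_inv[OF U] by (simp_all add: linear_on_def)
    then show "?i (c + d) = ?i c + ?i d" "?i (r *\<^sub>R c) = r *\<^sub>R ?i c"
      using triv_inv_triv[OF U] i subspace_add[OF fibre_subspace] subspace_scale[OF fibre_subspace]
      by metis+
  qed
  have repr: "(\<Sum>b\<in>onb. k (?i b) *\<^sub>R b) \<bullet> d = k (?i d)" if "linear_on (fibre E p) k"
    for k :: "'v \<Rightarrow> real" and d
  proof -
    have "(\<Sum>b\<in>onb. k (?i b) *\<^sub>R b) \<bullet> d = (\<Sum>b\<in>onb. (d \<bullet> b) *\<^sub>R k (?i b))"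
      unfolding inner_sum_left by (intro sum.cong) (simp_all add: inner_commute)
    then show ?thesis
      using linear_form_frame_expansion[OF U i[of d] that] by (simp add: triv_triv_inv[OF U])
  qed
  define T where "T c = (\<Sum>b\<in>onb. g p (?i c) (?i b) *\<^sub>R b)" for c
  have T: "T c \<bullet> d = g p (?i c) (?i d)" for c d
    unfolding T_def by (rule repr[OF metric_linear[OF i]])
  have "linear T"
  proof (rule linearI)
    have "g p (?i c + ?i d) (?i b) = g p (?i c) (?i b) + g p (?i d) (?i b)"
      "g p (r *\<^sub>R ?i c) (?i b) = r * g p (?i c) (?i b)" for b c d r
      using metric_linear_left[OF i[of b]] i by (simp_all add: linear_on_def)
    then show "T (c + d) = T c + T d" "T (r *\<^sub>R c) = r *\<^sub>R T c" for c d r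
      by (simp_all add: T_def add_i scale_i scaleR_left_distrib sum.distrib scaleR_sum_right)
  qed
  have "span (onb :: 'k set) = UNIV"
  proof -
    have "c \<in> span onb" for c :: 'k
    proof -
      have "(\<Sum>b\<in>onb. (c \<bullet> b) *\<^sub>R b) \<in> span onb" by (intro span_sum span_scale span_base)
      then show ?thesis by (simp add: fin)
    qed
    then show ?thesis by blast
  qed
  then have range_T: "range T = span (T ` onb)"
    using linear_span_image[OF \<open>linear T\<close>, of onb] by simp
  let ?x = "\<Sum>b\<in>onb. l (?i b) *\<^sub>R b"
  obtain c where c: "\<And>d. (?x - T c) \<bullet> T d = 0"
    using orthogonal_projection_exists[of "T ` onb" ?x] fin(1) unfolding range_T[symmetric] by auto
  have "?i (?x - T c) = 0"
  proof (rule metric_nondegenerate[OF i])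
    fix w assume w: "w \<in> fibre E p"
    show "g p (?i (?x - T c)) w = 0"
      using c[of "\<phi> p w"] metric_sym[OF i w] T[of "\<phi> p w" "?x - T c"]
      by (simp add: triv_inv_triv[OF U w] inner_commute)
  qed
  then have x: "?x = T c"
    using triv_triv_inv[OF U, of "?x - T c"] linear_on_0[OF triv_linear[OF U] fibre_subspace] by simp
  have "\<forall>w\<in>fibre E p. g p (?i c) w = l w"
  proof
    fix w assume w: "w \<in> fibre E p"
    show "g p (?i c) w = l w"
      using T[of c "\<phi> p w"] repr[OF l, of "\<phi> p w"] by (simp add: x triv_inv_triv[OF U w])
  qed
  then show ?thesis using i[of c] by (intro ex1I[of _ "?i c"]) (auto intro: metric_eqI)
qed

lemma
  assumes "\<omega> \<in> covector_fields atlas E"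
  shows sharp_fibre: "sharp E g \<omega> p \<in> fibre E p"
    and metric_sharp: "w \<in> fibre E p \<Longrightarrow> g p (sharp E g \<omega> p) w = \<omega> p w"
proof -
  have *: "sharp E g \<omega> p \<in> fibre E p \<and> (\<forall>w\<in>fibre E p. g p (sharp E g \<omega> p) w = \<omega> p w)"
    unfolding sharp_def by (rule theI'[OF metric_represents[OF covector_linear[OF assms]]])
  show "sharp E g \<omega> p \<in> fibre E p" by (rule conjunct1[OF *])
  show "w \<in> fibre E p \<Longrightarrow> g p (sharp E g \<omega> p) w = \<omega> p w" by (rule bspec[OF conjunct2[OF *]])
qed

text \<open>The frame coefficients \<open>s\<^sub>b\<close> of \<open>\<sharp> \<omega>\<close> satisfy \<open>\<Sum> g(e\<^sub>b, e\<^sub>w) s\<^sub>b = \<omega>(e\<^sub>w)\<close> for all model vectors \<open>w\<close>.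
  Nondegeneracy of the metric says that this system has trivial kernel.\<close>

lemma sharp_section:
  assumes \<omega>: "\<omega> \<in> covector_fields atlas E"
  shows "sharp E g \<omega> \<in> sections atlas E"
proof (rule sectionI)
  let ?v = "sharp E g \<omega>"
  show "?v p \<in> fibre E p" for p by (rule sharp_fibre[OF \<omega>])
  fix U \<phi> assume U: "(U, \<phi>) \<in> trivs E"
  show "smooth_map_on atlas U (\<lambda>p. \<phi> p (?v p))"
  proof (rule smooth_map_on_local)
    fix p assume p: "p \<in> U"
    let ?i = "triv_inv E \<phi>"
    have sum: "(\<Sum>b\<in>onb. g q (?i q b) (?i q w) * s b) = g q (?i q (\<Sum>b\<in>onb. s b *\<^sub>R b)) (?i q w)"
      if "q \<in> U" for q w s
      using linear_on_sum[OF metric_linear_left[OF triv_inv_fibre[OF U that]] fibre_subspace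
          triv_inv_fibre[OF U that], of s "\<lambda>b. b" onb w] triv_frame_sum[OF U that, of s]
      by (simp add: mult.commute)
    have "\<exists>V. open V \<and> p \<in> V \<and> (\<forall>b\<in>onb. smooth_map_on atlas V (\<lambda>q. \<phi> q (?v q) \<bullet> b))"
    proof (rule linear_system_solution_smooth[OF onb_fibre(1) triv_open[OF U] p,
          of "\<lambda>w b q. g q (?i q b) (?i q w)" "\<lambda>w q. \<omega> q (?i q w)"])
      show "smooth_map_on atlas U (\<lambda>q. g q (?i q b) (?i q w))" for w b
        by (rule metric_smooth[OF U])
      show "smooth_map_on atlas U (\<lambda>q. \<omega> q (?i q w))" for w
        by (rule covector_smooth[OF \<omega> U])
      show "(\<Sum>b\<in>onb. g q (?i q b) (?i q w) * (\<phi> q (?v q) \<bullet> b)) = \<omega> q (?i q w)"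
        if "q \<in> U" for w q
        using metric_sharp[OF \<omega> triv_inv_fibre[OF U that]]
        by (simp add: sum[OF that] onb_fibre triv_inv_triv[OF U that sharp_fibre[OF \<omega>]])
      show "\<forall>b\<in>onb. s b = 0" if s: "\<And>w. (\<Sum>b\<in>onb. g p (?i p b) (?i p w) * s b) = 0" for s
      proof
        fix b :: 'k assume b: "b \<in> onb"
        let ?c = "\<Sum>b\<in>onb. s b *\<^sub>R b"
        have "?i p ?c = 0"
        proof (rule metric_nondegenerate[OF triv_inv_fibre[OF U p]])
          fix w assume "w \<in> fibre E p"
          then show "g p (?i p ?c) w = 0"
            using s[of "\<phi> p w"] unfolding sum[OF p] by (simp add: triv_inv_triv[OF U p])
        qed
        then have "?c = 0"
          using triv_triv_inv[OF U p, of ?c] linear_on_0[OF triv_linear[OF U p] fibre_subspace] by simp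
        then show "s b = 0" using inner_onb_sum[OF fibre_model_finite_dim b, of s] by simp
      qed
    qed
    then obtain V where V: "open V" "p \<in> V"
        "\<And>b. b \<in> onb \<Longrightarrow> smooth_map_on atlas V (\<lambda>q. \<phi> q (?v q) \<bullet> b)" by blast
    have "smooth_map_on atlas V (\<lambda>q. \<Sum>b\<in>onb. (\<phi> q (?v q) \<bullet> b) *\<^sub>R b)"
      by (intro smooth_map_on_sum V(1) smooth_map_on_scaleR[OF V(1) V(3) smooth_map_on_const])
    then show "\<exists>V. open V \<and> p \<in> V \<and> smooth_map_on atlas V (\<lambda>p. \<phi> p (?v p))"
      using V by (auto simp: onb_fibre)
  qed
qed

lemma flat_covector:
  assumes X: "X \<in> sections atlas E"
  shows "flat E g X \<in> covector_fields atlas E"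
proof (rule covector_fieldI)
  show "linear_on (fibre E p) (flat E g X p)" for p
    using metric_linear[OF section_fibre[OF X], of p] subspace_add[OF fibre_subspace]
      subspace_scale[OF fibre_subspace] by (simp add: linear_on_def flat_def)
  show "flat E g X p v = 0" if "v \<notin> fibre E p" for p v using that by (simp add: flat_def)
  fix U \<phi> c assume U: "(U, \<phi>) \<in> trivs E"
  show "smooth_map_on atlas U (\<lambda>p. flat E g X p (triv_inv E \<phi> p c))"
  proof (rule smooth_map_on_cong[OF triv_open[OF U]])
    show "g p (X p) (triv_inv E \<phi> p c) = flat E g X p (triv_inv E \<phi> p c)" if "p \<in> U" for p
      by (simp add: flat_def triv_inv_fibre[OF U that])
    show "smooth_map_on atlas U (\<lambda>p. g p (X p) (triv_inv E \<phi> p c))"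
      by (rule linear_forms_smooth_on_section[OF U _ _ X, of "\<lambda>p v. g p v (triv_inv E \<phi> p c)"])
         (auto intro: metric_linear_left triv_inv_fibre[OF U] metric_smooth[OF U])
  qed
qed

lemma pairing_flat:
  "Y \<in> sections atlas E \<Longrightarrow> pairing (flat E g X) Y = metric_eval g X Y"
  by (simp add: pairing_def flat_def metric_eval_def section_fibre)

lemma metric_eval_smooth:
  "X \<in> sections atlas E \<Longrightarrow> Y \<in> sections atlas E \<Longrightarrow> metric_eval g X Y \<in> smooth_functions atlas"
  using pairing_smooth[OF flat_covector, of X Y] by (simp add: pairing_flat)

lemma metric_eval_sym:
  "X \<in> sections atlas E \<Longrightarrow> Y \<in> sections atlas E \<Longrightarrow> metric_eval g X Y = metric_eval g Y X"
  unfolding metric_eval_def by (rule ext) (rule metric_sym[OF section_fibre section_fibre])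

lemma
  assumes "X \<in> sections atlas E" "Y \<in> sections atlas E" "Z \<in> sections atlas E"
  shows metric_eval_add_left: "metric_eval g (X + Y) Z = metric_eval g X Z + metric_eval g Y Z"
    and metric_eval_add_right: "metric_eval g Z (X + Y) = metric_eval g Z X + metric_eval g Z Y"
    and metric_eval_scale_left:
      "metric_eval g (\<lambda>p. f p *\<^sub>R X p) Z = (\<lambda>p. f p * metric_eval g X Z p)"
    and metric_eval_scale_right:
      "metric_eval g Z (\<lambda>p. f p *\<^sub>R X p) = (\<lambda>p. f p * metric_eval g Z X p)"
  using metric_linear_left[OF section_fibre[OF assms(3)]] metric_linear[OF section_fibre[OF assms(3)]]
  by (simp_all add: metric_eval_def fun_eq_iff linear_on_def section_fibre assms)

lemma metric_eval_sharp:
  assumes "\<omega> \<in> covector_fields atlas E" "Y \<in> sections atlas E"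
  shows "metric_eval g (sharp E g \<omega>) Y = pairing \<omega> Y"
  by (simp add: metric_eval_def pairing_def metric_sharp[OF assms(1) section_fibre[OF assms(2)]])

lemma section_eqI:
  assumes "X \<in> sections atlas E" "Y \<in> sections atlas E"
    and "\<And>Z. Z \<in> sections atlas E \<Longrightarrow> metric_eval g X Z = metric_eval g Y Z"
  shows "X = Y"
proof
  fix p
  show "X p = Y p"
  proof (rule metric_eqI[OF section_fibre[OF assms(1)] section_fibre[OF assms(2)]])
    fix w assume "w \<in> fibre E p"
    then obtain Z where "Z \<in> sections atlas E" "Z p = w" by (rule section_through)
    then show "g p (X p) w = g p (Y p) w"
      using fun_cong[OF assms(3)[of Z], of p] by (simp add: metric_eval_def)
  qed
qed

end

section \<open>The anchor as a derivation\<close>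

context smooth_manifold
begin

lemma smooth_function_differentiable:
  assumes "f \<in> smooth_functions atlas" "(U, x) \<in> atlas" "p \<in> U"
  shows "(f \<circ> inv_into U x has_derivative frechet_derivative (f \<circ> inv_into U x) (at (x p))) (at (x p))"
proof (rule C_differentiable_on_SucD)
  show "C_differentiable_on (Suc 0) (x ` (U \<inter> UNIV)) (f \<circ> inv_into U x)"
    using smooth_map_onD[OF smooth_map_on_smooth_function[OF assms(1)] assms(2)]
    unfolding comp_def .
qed (use assms(3) in simp)

text \<open>By the chain rule, \<open>w'\<close> is the image of \<open>w\<close> under the derivative of the chart transition.\<close>

lemma chart_tangent_change_chart:
  assumes U: "(U, x) \<in> atlas" "p \<in> U" and V: "(V, y) \<in> atlas" "p \<in> V"
  shows "\<exists>w'. chart_tangent atlas U x p w = chart_tangent atlas V y p w'"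
proof -
  let ?\<tau> = "y \<circ> inv_into U x"
  have "C_differentiable_on (Suc 0) (x ` (U \<inter> V)) ?\<tau>"
    using chart_transition[OF U(1) V(1)] unfolding smooth_on_def by blast
  then have \<tau>: "(?\<tau> has_derivative frechet_derivative ?\<tau> (at (x p))) (at (x p))"
    by (rule C_differentiable_on_SucD) (use U V in blast)
  have "frechet_derivative (f \<circ> inv_into U x) (at (x p)) w =
      frechet_derivative (f \<circ> inv_into V y) (at (y p)) (frechet_derivative ?\<tau> (at (x p)) w)"
    if f: "f \<in> smooth_functions atlas" for f
  proof -
    have "(f \<circ> inv_into V y has_derivative frechet_derivative (f \<circ> inv_into V y) (at (y p)))
        (at (?\<tau> (x p)))"
      using smooth_function_differentiable[OF f V] by (simp add: inv_into_chart[OF U])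
    from diff_chain_at[OF \<tau> this] have "((f \<circ> inv_into V y) \<circ> ?\<tau> has_derivative
        frechet_derivative (f \<circ> inv_into V y) (at (y p)) \<circ> frechet_derivative ?\<tau> (at (x p))) (at (x p))"
      .
    then have "(f \<circ> inv_into U x has_derivative
        frechet_derivative (f \<circ> inv_into V y) (at (y p)) \<circ> frechet_derivative ?\<tau> (at (x p))) (at (x p))"
    proof (rule has_derivative_transform_within_open)
      show "open (x ` (U \<inter> V))"
        by (rule open_chart_image[OF U(1)]) (use chart_open[OF V(1)] in blast)
      show "x p \<in> x ` (U \<inter> V)" using U V by blast
      show "((f \<circ> inv_into V y) \<circ> ?\<tau>) z = (f \<circ> inv_into U x) z" if "z \<in> x ` (U \<inter> V)" for z
        using that inv_into_chart[OF U(1)] inv_into_chart[OF V(1)] by auto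
    qed
    from frechet_derivative_at[OF this] show ?thesis by (simp add: fun_eq_iff)
  qed
  then show ?thesis
    by (intro exI[of _ "frechet_derivative ?\<tau> (at (x p)) w"]) (simp add: chart_tangent_def fun_eq_iff)
qed

lemma
  assumes "(U, x) \<in> atlas" "p \<in> U"
    and "f \<in> smooth_functions atlas" "h \<in> smooth_functions atlas"
  shows chart_tangent_add: "chart_tangent atlas U x p w (f + h) =
      chart_tangent atlas U x p w f + chart_tangent atlas U x p w h"
    and chart_tangent_mult: "chart_tangent atlas U x p w (\<lambda>q. f q * h q) =
      f p * chart_tangent atlas U x p w h + h p * chart_tangent atlas U x p w f"
proof -
  note f = smooth_function_differentiable[OF assms(3,1,2)]
    and h = smooth_function_differentiable[OF assms(4,1,2)]
  have "(f + h) \<circ> inv_into U x = (\<lambda>z. (f \<circ> inv_into U x) z + (h \<circ> inv_into U x) z)" by auto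
  then show "chart_tangent atlas U x p w (f + h) =
      chart_tangent atlas U x p w f + chart_tangent atlas U x p w h"
    using fun_cong[OF frechet_derivative_at[OF has_derivative_add[OF f h]], of w] assms(3,4)
      smooth_functions_add[OF assms(3,4)]
    by (simp add: chart_tangent_def)
  have "(\<lambda>q. f q * h q) \<circ> inv_into U x = (\<lambda>z. (f \<circ> inv_into U x) z * (h \<circ> inv_into U x) z)" by auto
  then show "chart_tangent atlas U x p w (\<lambda>q. f q * h q) =
      f p * chart_tangent atlas U x p w h + h p * chart_tangent atlas U x p w f"
    using fun_cong[OF frechet_derivative_at[OF has_derivative_mult[OF f h]], of w] assms(3,4)
      smooth_functions_mult[OF assms(3,4)] inv_into_chart[OF assms(1,2)]
    by (simp add: chart_tangent_def mult.commute)
qed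

end

context skew_symmetric_algebroid
begin

lemma anchor_linear: "linear_on (fibre A p) (\<rho> p)"
  using anchor_hom unfolding bundle_hom_def by simp

lemma anchor_linear_eval: "linear_on (fibre A p) (\<lambda>v. \<rho> p v f)"
  using anchor_linear[of p] by (simp add: linear_on_def scaleR_fun_def)

lemma anchor_in_chart:
  assumes "(V, y) \<in> atlas" "p \<in> V" "v \<in> fibre A p"
  shows "\<exists>w. \<rho> p v = chart_tangent atlas V y p w"
proof -
  have "\<rho> p ` fibre A p \<subseteq> fibre (tangent_bundle atlas) p"
    using anchor_hom unfolding bundle_hom_def by simp
  then have "\<rho> p v \<in> fibre (tangent_bundle atlas) p" using assms(3) by blast
  then obtain U x w where "(U, x) \<in> atlas" "p \<in> U" "\<rho> p v = chart_tangent atlas U x p w"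
    by (auto simp: tangent_bundle_def)
  then show ?thesis using chart_tangent_change_chart[OF _ _ assms(1,2)] by metis
qed

text \<open>In a chart \<open>y\<close> the anchor of a frame vector has smooth components \<open>w\<close>, by the local
  representative of \<open>\<rho>\<close> in the trivialisation of the tangent bundle that belongs to the same chart
  \<open>y\<close>. Its action on \<open>f\<close> is the combination of the partial derivatives of \<open>f \<circ> y\<^sup>-\<^sup>1\<close> with these
  coefficients.\<close>

lemma anchor_frame_smooth:
  assumes U: "(U, \<phi>) \<in> trivs A" and f: "f \<in> smooth_functions atlas"
  shows "smooth_map_on atlas U (\<lambda>p. \<rho> p (triv_inv A \<phi> p c) f)"
proof (rule smooth_map_onI)
  fix V y n assume V: "(V, y) \<in> atlas"
  note fin = finite_onb[OF model_finite_dim] onb_expansion[OF model_finite_dim]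
  let ?S = "y ` (V \<inter> U)" and ?i = "inv_into V y"
  let ?D = "\<lambda>z. frechet_derivative (f \<circ> ?i) (at z)"
  define w where "w q = inv (chart_tangent atlas V y q) (\<rho> q (triv_inv A \<phi> q c))" for q
  have S: "open ?S" by (rule open_chart_image[OF V triv_open[OF U]])
  have "(V, \<lambda>q. inv (chart_tangent atlas V y q)) \<in> trivs (tangent_bundle atlas)"
    using V by (auto simp: tangent_bundle_def)
  then have "smooth_map_on atlas (U \<inter> V) w"
    using anchor_hom U unfolding bundle_hom_def w_def by fastforce
  from smooth_map_onD[OF this V, of n] have w: "C_differentiable_on n ?S (\<lambda>z. w (?i z))"
    by (simp add: Int_commute Int_left_commute)
  have D: "C_differentiable_on n ?S (\<lambda>z. ?D z e)" for e
  proof -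
    have "C_differentiable_on (Suc n) (y ` (V \<inter> UNIV)) (f \<circ> ?i)"
      using smooth_map_onD[OF smooth_map_on_smooth_function[OF f] V] unfolding comp_def .
    then have "C_differentiable_on n (y ` (V \<inter> UNIV)) (\<lambda>z. ?D z e)" by simp
    then show ?thesis by (rule C_differentiable_on_subset) blast
  qed
  show "C_differentiable_on n ?S (\<lambda>z. \<rho> (?i z) (triv_inv A \<phi> (?i z) c) f)"
  proof (rule C_differentiable_on_cong[OF S])
    show "C_differentiable_on n ?S (\<lambda>z. \<Sum>e\<in>onb. (w (?i z) \<bullet> e) * ?D z e)"
      by (intro C_differentiable_on_sum[OF S] C_differentiable_on_bilinear[OF S bounded_bilinear_mult]
          C_differentiable_on_bilinear[OF S bounded_bilinear_inner w] C_differentiable_on_const D)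
    fix z assume "z \<in> ?S"
    then obtain q where q: "q \<in> V" "q \<in> U" "z = y q" by blast
    \<comment> \<open>The inverse in \<open>w\<close> stands for a choice of preimage, which is one as soon as the anchor takes
      values in the range of \<open>chart_tangent\<close>.\<close>
    have "\<rho> q (triv_inv A \<phi> q c) \<in> range (chart_tangent atlas V y q)"
      using anchor_in_chart[OF V q(1) triv_inv_fibre[OF U q(2)]] by auto
    then have "\<rho> q (triv_inv A \<phi> q c) = chart_tangent atlas V y q (w q)"
      unfolding w_def by (simp add: f_inv_into_f)
    then have "\<rho> q (triv_inv A \<phi> q c) f = ?D z (\<Sum>e\<in>onb. (w q \<bullet> e) *\<^sub>R e)"
      by (simp add: chart_tangent_def f fin q(3))
    also have "\<dots> = (\<Sum>e\<in>onb. (w q \<bullet> e) * ?D z e)"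
    proof -
      have "linear (?D z)"
        using smooth_function_differentiable[OF f V q(1)] unfolding q(3)
        by (rule has_derivative_linear)
      then show ?thesis by (simp add: linear_sum linear_scale)
    qed
    finally show "(\<Sum>e\<in>onb. (w (?i z) \<bullet> e) * ?D z e) = \<rho> (?i z) (triv_inv A \<phi> (?i z) c) f"
      using q by (simp add: inv_into_chart[OF V])
  qed
qed

lemma anchor_deriv_smooth:
  assumes "X \<in> sections atlas A" "f \<in> smooth_functions atlas"
  shows "anchor_deriv \<rho> X f \<in> smooth_functions atlas"
  unfolding anchor_deriv_def
  by (rule smooth_function_if_smooth_on_trivs,
      rule linear_forms_smooth_on_section[OF _ anchor_linear_eval _ assms(1)])
     (auto intro: anchor_frame_smooth assms(2))

lemma
  assumes "X \<in> sections atlas A" "f \<in> smooth_functions atlas" "h \<in> smooth_functions atlas"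
  shows anchor_deriv_add: "anchor_deriv \<rho> X (f + h) = anchor_deriv \<rho> X f + anchor_deriv \<rho> X h"
    and anchor_deriv_mult: "anchor_deriv \<rho> X (\<lambda>p. f p * h p) =
      (\<lambda>p. f p * anchor_deriv \<rho> X h p + h p * anchor_deriv \<rho> X f p)"
proof -
  have *: "\<rho> p (X p) (f + h) = \<rho> p (X p) f + \<rho> p (X p) h \<and>
      \<rho> p (X p) (\<lambda>p. f p * h p) = f p * \<rho> p (X p) h + h p * \<rho> p (X p) f" for p
  proof -
    obtain U x where U: "(U, x) \<in> atlas" "p \<in> U" by (rule chart_at)
    obtain w where "\<rho> p (X p) = chart_tangent atlas U x p w"
      using anchor_in_chart[OF U section_fibre[OF assms(1)]] by blast
    then show ?thesis
      using chart_tangent_add[OF U assms(2,3)] chart_tangent_mult[OF U assms(2,3)] by simp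
  qed
  then show "anchor_deriv \<rho> X (f + h) = anchor_deriv \<rho> X f + anchor_deriv \<rho> X h"
    "anchor_deriv \<rho> X (\<lambda>p. f p * h p) =
      (\<lambda>p. f p * anchor_deriv \<rho> X h p + h p * anchor_deriv \<rho> X f p)"
    by (simp_all add: anchor_deriv_def fun_eq_iff)
qed

lemma anchor_deriv_const:
  assumes "X \<in> sections atlas A"
  shows "anchor_deriv \<rho> X (\<lambda>p. c) p = 0"
proof -
  obtain U x where U: "(U, x) \<in> atlas" "p \<in> U" by (rule chart_at)
  obtain w where "\<rho> p (X p) = chart_tangent atlas U x p w"
    using anchor_in_chart[OF U section_fibre[OF assms]] by blast
  then show ?thesis by (simp add: anchor_deriv_def chart_tangent_def comp_def)
qed

lemma
  assumes "X \<in> sections atlas A" "Y \<in> sections atlas A"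
  shows anchor_deriv_add_section:
      "anchor_deriv \<rho> (X + Y) f = anchor_deriv \<rho> X f + anchor_deriv \<rho> Y f"
    and anchor_deriv_scale_section:
      "anchor_deriv \<rho> (\<lambda>p. h p *\<^sub>R X p) f = (\<lambda>p. h p * anchor_deriv \<rho> X f p)"
  using anchor_linear_eval section_fibre[OF assms(1)] section_fibre[OF assms(2)]
  by (simp_all add: linear_on_def anchor_deriv_def fun_eq_iff)

lemma differential_covector:
  assumes "f \<in> smooth_functions atlas"
  shows "differential A \<rho> f \<in> covector_fields atlas A"
proof (rule covector_fieldI)
  show "linear_on (fibre A p) (differential A \<rho> f p)" for p
    using anchor_linear_eval[of p f] subspace_add[OF fibre_subspace] subspace_scale[OF fibre_subspace]
    by (simp add: linear_on_def differential_def)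
  show "differential A \<rho> f p v = 0" if "v \<notin> fibre A p" for p v
    using that by (simp add: differential_def)
  fix U \<phi> c assume U: "(U, \<phi>) \<in> trivs A"
  show "smooth_map_on atlas U (\<lambda>p. differential A \<rho> f p (triv_inv A \<phi> p c))"
    by (rule smooth_map_on_cong[OF triv_open[OF U] _ anchor_frame_smooth[OF U assms]])
       (simp add: differential_def triv_inv_fibre[OF U])
qed

lemma pairing_differential:
  "Y \<in> sections atlas A \<Longrightarrow> pairing (differential A \<rho> f) Y = anchor_deriv \<rho> Y f"
  by (simp add: pairing_def differential_def anchor_deriv_def section_fibre)

section \<open>The bracket and the Lie derivative of covector fields\<close>

lemma
  assumes "X \<in> sections atlas A" "Y \<in> sections atlas A"
  shows bracket_section: "br X Y \<in> sections atlas A"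
    and bracket_add_right: "Z \<in> sections atlas A \<Longrightarrow> br X (Y + Z) = br X Y + br X Z"
    and bracket_add_left: "Z \<in> sections atlas A \<Longrightarrow> br (X + Z) Y = br X Y + br Z Y"
    and bracket_scale_right: "f \<in> smooth_functions atlas \<Longrightarrow>
      br X (\<lambda>p. f p *\<^sub>R Y p) = (\<lambda>p. f p *\<^sub>R br X Y p + anchor_deriv \<rho> X f p *\<^sub>R Y p)"
  using bracket_leibniz assms unfolding leibniz_bracket_def linear_on_def by simp_all

lemma bracket_scale_left:
  assumes "X \<in> sections atlas A" "Y \<in> sections atlas A" "f \<in> smooth_functions atlas"
  shows "br (\<lambda>p. f p *\<^sub>R X p) Y = (\<lambda>p. f p *\<^sub>R br X Y p + (- anchor_deriv \<rho> Y f p) *\<^sub>R X p)"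
  using bracket_skew[OF section_scaleR[OF assms(3,1)] assms(2)] bracket_scale_right[OF assms(2,1,3)]
    bracket_skew[OF assms(1,2)]
  by (simp add: fun_eq_iff)

lemma
  assumes "\<omega> \<in> covector_fields atlas A" "X \<in> sections atlas A" "Y \<in> sections atlas A"
  shows pairing_add: "pairing \<omega> (X + Y) = pairing \<omega> X + pairing \<omega> Y"
    and pairing_scale: "pairing \<omega> (\<lambda>p. f p *\<^sub>R X p) = (\<lambda>p. f p * pairing \<omega> X p)"
    and pairing_scale_add: "pairing \<omega> (\<lambda>p. f p *\<^sub>R X p + h p *\<^sub>R Y p) =
      (\<lambda>p. f p * pairing \<omega> X p + h p * pairing \<omega> Y p)"
  using covector_linear[OF assms(1)] section_fibre[OF assms(2)] section_fibre[OF assms(3)]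
    subspace_scale[OF fibre_subspace]
  by (simp_all add: pairing_def linear_on_def fun_eq_iff)

text \<open>The terms \<open>(\<rho> \<circ> X)(f) \<omega>(Y)\<close> produced by the derivation property of the anchor and by the
  Leibniz rule of the bracket cancel, which makes the Lie derivative tensorial in \<open>Y\<close>.\<close>

lemma lie_covector_exists:
  assumes X: "X \<in> sections atlas A" and \<omega>: "\<omega> \<in> covector_fields atlas A"
  shows "\<exists>!\<eta>. \<eta> \<in> covector_fields atlas A \<and> (\<forall>Y\<in>sections atlas A.
    pairing \<eta> Y = anchor_deriv \<rho> X (pairing \<omega> Y) - pairing \<omega> (br X Y))"
proof (rule covector_field_of_tensorial)
  fix Y assume Y: "Y \<in> sections atlas A"
  note smooth = pairing_smooth[OF \<omega>] anchor_deriv_smooth[OF X]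
  show "anchor_deriv \<rho> X (pairing \<omega> Y) - pairing \<omega> (br X Y) \<in> smooth_functions atlas"
    using smooth_map_on_diff[of UNIV "anchor_deriv \<rho> X (pairing \<omega> Y)" "pairing \<omega> (br X Y)"]
      smooth(2)[OF smooth(1)[OF Y]] smooth(1)[OF bracket_section[OF X Y]]
    by (simp add: smooth_functions_def fun_diff_def)
  show "anchor_deriv \<rho> X (pairing \<omega> (Y + Z)) - pairing \<omega> (br X (Y + Z)) =
      (anchor_deriv \<rho> X (pairing \<omega> Y) - pairing \<omega> (br X Y)) +
      (anchor_deriv \<rho> X (pairing \<omega> Z) - pairing \<omega> (br X Z))" if Z: "Z \<in> sections atlas A" for Z
    by (simp add: pairing_add[OF \<omega> Y Z] bracket_add_right[OF X Y Z]
        pairing_add[OF \<omega> bracket_section[OF X Y] bracket_section[OF X Z]]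
        anchor_deriv_add[OF X pairing_smooth[OF \<omega> Y] pairing_smooth[OF \<omega> Z]])
  show "anchor_deriv \<rho> X (pairing \<omega> (\<lambda>p. f p *\<^sub>R Y p)) - pairing \<omega> (br X (\<lambda>p. f p *\<^sub>R Y p)) =
      (\<lambda>p. f p * (anchor_deriv \<rho> X (pairing \<omega> Y) - pairing \<omega> (br X Y)) p)"
    if f: "f \<in> smooth_functions atlas" for f
    by (simp add: pairing_scale[OF \<omega> Y Y] bracket_scale_right[OF X Y f]
        pairing_scale_add[OF \<omega> bracket_section[OF X Y] Y]
        anchor_deriv_mult[OF X f pairing_smooth[OF \<omega> Y]] fun_eq_iff algebra_simps)
qed

lemma
  assumes "X \<in> sections atlas A" "\<omega> \<in> covector_fields atlas A"
  shows lie_covector_covector: "lie_covector atlas A \<rho> br X \<omega> \<in> covector_fields atlas A"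
    and pairing_lie_covector: "Y \<in> sections atlas A \<Longrightarrow> pairing (lie_covector atlas A \<rho> br X \<omega>) Y =
      anchor_deriv \<rho> X (pairing \<omega> Y) - pairing \<omega> (br X Y)"
proof -
  note * = theI'[OF lie_covector_exists[OF assms], folded lie_covector_def]
  show "lie_covector atlas A \<rho> br X \<omega> \<in> covector_fields atlas A" by (rule conjunct1[OF *])
  show "Y \<in> sections atlas A \<Longrightarrow> pairing (lie_covector atlas A \<rho> br X \<omega>) Y =
      anchor_deriv \<rho> X (pairing \<omega> Y) - pairing \<omega> (br X Y)" by (rule bspec[OF conjunct2[OF *]])
qed

end

section \<open>The symmetric bracket of a metric\<close>

locale metric_algebroid =
  skew_symmetric_algebroid atlas A \<rho> br + metric_bundle atlas A g
  for atlas :: "('m::{t2_space, second_countable_topology}, 'e::real_inner) atlas"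
    and A :: "('m, 'v::real_vector, 'k::real_inner) vbundle"
    and \<rho> :: "'m \<Rightarrow> 'v \<Rightarrow> ('m \<Rightarrow> real) \<Rightarrow> real"
    and br :: "('m \<Rightarrow> 'v) \<Rightarrow> ('m \<Rightarrow> 'v) \<Rightarrow> ('m \<Rightarrow> 'v)"
    and g :: "'m \<Rightarrow> 'v \<Rightarrow> 'v \<Rightarrow> real"
begin

abbreviation "sym_br \<equiv> metric_bracket atlas A \<rho> br g"

lemma metric_bracket_covector:
  assumes "X \<in> sections atlas A" "Y \<in> sections atlas A"
  shows "lie_covector atlas A \<rho> br X (flat A g Y) + lie_covector atlas A \<rho> br Y (flat A g X)
    - differential A \<rho> (metric_eval g X Y) \<in> covector_fields atlas A"
  by (intro covector_diff covector_add lie_covector_covector flat_covector differential_covector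
      metric_eval_smooth assms)

lemma metric_bracket_section:
  "X \<in> sections atlas A \<Longrightarrow> Y \<in> sections atlas A \<Longrightarrow> sym_br X Y \<in> sections atlas A"
  unfolding metric_bracket_def by (intro sharp_section metric_bracket_covector)

text \<open>As \<open>g\<close> undoes \<open>\<sharp>\<close>, the left-hand side is the value on \<open>Z\<close> of the covector field that defines
  the bracket. By nondegeneracy the formula characterises the bracket, and all its properties are
  read off from the right-hand side.\<close>

lemma metric_bracket_koszul:
  assumes X: "X \<in> sections atlas A" and Y: "Y \<in> sections atlas A" and Z: "Z \<in> sections atlas A"
  shows "metric_eval g (sym_br X Y) Z =
    anchor_deriv \<rho> X (metric_eval g Y Z) - metric_eval g Y (br X Z) +
    (anchor_deriv \<rho> Y (metric_eval g X Z) - metric_eval g X (br Y Z)) -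
    anchor_deriv \<rho> Z (metric_eval g X Y)"
proof -
  have "pairing (\<omega> + \<eta> - \<theta>) Z = pairing \<omega> Z + pairing \<eta> Z - pairing \<theta> Z" for \<omega> \<eta> \<theta>
    by (simp add: pairing_def fun_eq_iff)
  then show ?thesis
    unfolding metric_bracket_def metric_eval_sharp[OF metric_bracket_covector[OF X Y] Z]
    by (simp add: pairing_lie_covector[OF X flat_covector[OF Y] Z] pairing_flat[OF Z]
        pairing_lie_covector[OF Y flat_covector[OF X] Z] pairing_differential[OF Z]
        pairing_flat[OF bracket_section[OF X Z]] pairing_flat[OF bracket_section[OF Y Z]])
qed

lemma metric_bracket_sym:
  assumes X: "X \<in> sections atlas A" and Y: "Y \<in> sections atlas A"
  shows "sym_br X Y = sym_br Y X"
proof (rule section_eqI)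
  fix Z assume Z: "Z \<in> sections atlas A"
  show "metric_eval g (sym_br X Y) Z = metric_eval g (sym_br Y X) Z"
    unfolding metric_bracket_koszul[OF X Y Z] metric_bracket_koszul[OF Y X Z]
      metric_eval_sym[OF Y X] by simp
qed (intro metric_bracket_section X Y)+

lemma metric_bracket_add_right:
  assumes X: "X \<in> sections atlas A" and Y: "Y \<in> sections atlas A" and Y': "Y' \<in> sections atlas A"
  shows "sym_br X (Y + Y') = sym_br X Y + sym_br X Y'"
proof (rule section_eqI)
  fix Z assume Z: "Z \<in> sections atlas A"
  note sm = metric_eval_smooth
  note XZ = bracket_section[OF X Z] and YZ = bracket_section[OF Y Z] and YZ' = bracket_section[OF Y' Z]
  show "metric_eval g (sym_br X (Y + Y')) Z = metric_eval g (sym_br X Y + sym_br X Y') Z"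
    by (simp add: metric_eval_add_left[OF metric_bracket_section[OF X Y] metric_bracket_section[OF X Y'] Z]
        metric_bracket_koszul[OF X section_add[OF Y Y'] Z]
        metric_bracket_koszul[OF X Y Z] metric_bracket_koszul[OF X Y' Z]
        metric_eval_add_left[OF Y Y' Z] metric_eval_add_left[OF Y Y' XZ]
        bracket_add_left[OF Y Z Y'] metric_eval_add_right[OF YZ YZ' X]
        metric_eval_add_right[OF Y Y' X] anchor_deriv_add_section[OF Y Y']
        anchor_deriv_add[OF X sm[OF Y Z] sm[OF Y' Z]] anchor_deriv_add[OF Z sm[OF X Y] sm[OF X Y']])
qed (intro metric_bracket_section section_add X Y Y')+

text \<open>Replacing \<open>Y\<close> by \<open>f Y\<close> in the Koszul-type formula produces \<open>Z(f) g(X,Y)\<close> twice, with opposite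
  signs: from \<open>[f Y, Z]\<close> and from \<open>Z(g(X, f Y))\<close>. Only the term \<open>X(f) g(Y,Z)\<close> remains.\<close>

lemma metric_bracket_leibniz:
  assumes X: "X \<in> sections atlas A" and Y: "Y \<in> sections atlas A" and f: "f \<in> smooth_functions atlas"
  shows "sym_br X (\<lambda>p. f p *\<^sub>R Y p) = (\<lambda>p. f p *\<^sub>R sym_br X Y p + anchor_deriv \<rho> X f p *\<^sub>R Y p)"
proof -
  let ?fY = "\<lambda>p. f p *\<^sub>R Y p"
  note S = metric_bracket_section[OF X Y] and Xf = anchor_deriv_smooth[OF X f]
  have fS: "(\<lambda>p. f p *\<^sub>R sym_br X Y p) \<in> sections atlas A" by (rule section_scaleR[OF f S])
  have fY: "?fY \<in> sections atlas A" by (rule section_scaleR[OF f Y])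
  have XfY: "(\<lambda>p. anchor_deriv \<rho> X f p *\<^sub>R Y p) \<in> sections atlas A" by (rule section_scaleR[OF Xf Y])
  have "sym_br X ?fY = (\<lambda>p. f p *\<^sub>R sym_br X Y p) + (\<lambda>p. anchor_deriv \<rho> X f p *\<^sub>R Y p)"
  proof (rule section_eqI)
    fix Z assume Z: "Z \<in> sections atlas A"
    note XZ = bracket_section[OF X Z] and YZ = bracket_section[OF Y Z]
    have fYZ: "br ?fY Z = (\<lambda>p. f p *\<^sub>R br Y Z p) + (\<lambda>p. (- anchor_deriv \<rho> Z f p) *\<^sub>R Y p)"
      unfolding bracket_scale_left[OF Y Z f] by (simp add: fun_eq_iff)
    have "(\<lambda>p. - 1 * anchor_deriv \<rho> Z f p) \<in> smooth_functions atlas"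
      by (rule smooth_functions_mult[OF smooth_functions_const anchor_deriv_smooth[OF Z f]])
    then have Zf: "(\<lambda>p. - anchor_deriv \<rho> Z f p) \<in> smooth_functions atlas" by simp
    have "metric_eval g X (br ?fY Z) =
        (\<lambda>p. f p * metric_eval g X (br Y Z) p) + (\<lambda>p. - anchor_deriv \<rho> Z f p * metric_eval g X Y p)"
      unfolding fYZ metric_eval_add_right[OF section_scaleR[OF f YZ] section_scaleR[OF Zf Y] X]
        metric_eval_scale_right[OF YZ YZ X] metric_eval_scale_right[OF Y Y X]
      by (rule refl)
    then show "metric_eval g (sym_br X ?fY) Z =
        metric_eval g ((\<lambda>p. f p *\<^sub>R sym_br X Y p) + (\<lambda>p. anchor_deriv \<rho> X f p *\<^sub>R Y p)) Z"
      unfolding metric_eval_add_left[OF fS XfY Z] metric_eval_scale_left[OF S S Z]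
        metric_eval_scale_left[OF Y Y Z] metric_eval_scale_left[OF Y Y XZ]
        metric_eval_scale_right[OF Y Y X] metric_bracket_koszul[OF X fY Z]
        metric_bracket_koszul[OF X Y Z] anchor_deriv_scale_section[OF Y Y]
        anchor_deriv_mult[OF X f metric_eval_smooth[OF Y Z]]
        anchor_deriv_mult[OF Z f metric_eval_smooth[OF X Y]]
      by (simp add: fun_eq_iff algebra_simps)
  qed (intro metric_bracket_section section_add X fY fS XfY)+
  then show ?thesis by (simp add: fun_eq_iff)
qed

text \<open>Homogeneity is the Leibniz rule for constant functions, which the anchor kills; linearity in the
  first argument follows by symmetry.\<close>

lemma metric_bracket_symmetric_bracket: "symmetric_bracket atlas A \<rho> sym_br"
proof -
  have scale: "sym_br X (c *\<^sub>R Y) = c *\<^sub>R sym_br X Y"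
    if "X \<in> sections atlas A" "Y \<in> sections atlas A" for X Y c
    using metric_bracket_leibniz[OF that smooth_functions_const[of c]]
    by (simp add: scaleR_fun_def anchor_deriv_const[OF that(1)])
  have linear: "linear_on (sections atlas A) (\<lambda>Y. sym_br X Y)" if "X \<in> sections atlas A" for X
    using metric_bracket_add_right[OF that] scale[OF that] by (simp add: linear_on_def)
  have "linear_on (sections atlas A) (\<lambda>X. sym_br X Y)" if Y: "Y \<in> sections atlas A" for Y
    using linear[OF Y] metric_bracket_sym[OF _ Y] section_add section_const_scaleR
    by (simp add: linear_on_def)
  then show ?thesis
    unfolding symmetric_bracket_def leibniz_bracket_def
    using linear metric_bracket_section metric_bracket_leibniz metric_bracket_sym by blast
qed

text \<open>In \<open>g(\<langle>X:Y\<rangle>, Z) + g(Y, \<langle>X:Z\<rangle>)\<close> the terms that differentiate along \<open>Y\<close> and \<open>Z\<close> and the terms with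
  \<open>[Y,Z]\<close> are antisymmetric in \<open>Y, Z\<close> and cancel. What remains is
  \<open>2 X(g(Y,Z)) - g([X,Y],Z) - g(Y,[X,Z])\<close>.\<close>

lemma lie_metric_metric_bracket:
  assumes X: "X \<in> sections atlas A" and Y: "Y \<in> sections atlas A" and Z: "Z \<in> sections atlas A"
  shows "lie_metric \<rho> sym_br X g Y Z = - lie_metric \<rho> br X g Y Z"
proof -
  note XY = bracket_section[OF X Y] and XZ = bracket_section[OF X Z]
    and YZ = bracket_section[OF Y Z] and ZY = bracket_section[OF Z Y]
  have "br Z Y = (\<lambda>p. (- 1) *\<^sub>R br Y Z p)"
    using bracket_skew[OF Z Y] by (simp add: fun_eq_iff)
  then have skew: "metric_eval g X (br Z Y) = (\<lambda>p. - metric_eval g X (br Y Z) p)"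
    using metric_eval_scale_right[OF YZ YZ X, of "\<lambda>p. - 1"] by simp
  have "metric_eval g Y (sym_br X Z) = metric_eval g (sym_br X Z) Y"
    by (rule metric_eval_sym[OF Y metric_bracket_section[OF X Z]])
  then show ?thesis
    unfolding lie_metric_def
    by (simp add: metric_bracket_koszul[OF X Y Z] metric_bracket_koszul[OF X Z Y] skew
        metric_eval_sym[OF Z Y] metric_eval_sym[OF XY Z] fun_eq_iff)
qed

end

theorem theorem5p4:
  fixes atlas :: "('m::{t2_space, second_countable_topology}, 'e::real_inner) atlas"
    and A :: "('m, 'v::real_vector, 'k::real_inner) vbundle"
    and \<rho> :: "'m \<Rightarrow> 'v \<Rightarrow> ('m \<Rightarrow> real) \<Rightarrow> real"
    and br :: "('m \<Rightarrow> 'v) \<Rightarrow> ('m \<Rightarrow> 'v) \<Rightarrow> ('m \<Rightarrow> 'v)"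
    and g :: "'m \<Rightarrow> 'v \<Rightarrow> 'v \<Rightarrow> real"
  assumes "skew_symmetric_algebroid atlas A \<rho> br"
    and "pseudo_riemannian_metric atlas A g"
  shows "symmetric_bracket atlas A \<rho> (metric_bracket atlas A \<rho> br g) \<and>
    (\<forall>X\<in>sections atlas A. \<forall>Y\<in>sections atlas A. \<forall>Z\<in>sections atlas A.
      lie_metric \<rho> (metric_bracket atlas A \<rho> br g) X g Y Z = - lie_metric \<rho> br X g Y Z)"
proof -
  interpret skew_symmetric_algebroid atlas A \<rho> br by (rule assms(1))
  interpret metric_algebroid atlas A \<rho> br g by unfold_locales (rule assms(2))
  show ?thesis using metric_bracket_symmetric_bracket lie_metric_metric_bracket by blast
qed

end
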